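(* Let $\Phi=\{\varphi_i(x)=\rho_ix+a_i\}_{i\in\Gamma}$ be a self-similar iterated function system on $\mathbb{R}$, with $0<\rho_i<1$ and $a_i\in\mathbb{R}$, satisfying the weak separation condition, and let $\mu$ be a self-similar measure associated to $\Phi$. If $s>1$ is a Pisot number and $\frac{\log s}{\log\rho_i}\notin\mathbb{Q}$ for some $i\in\Gamma$, then $\mu$ is pointwise $s$-normal.
   Context: $\Gamma=\{1,\dots,m\}$, $m\ge2$. The attractor $K$ is the unique nonempty compact set with $K=\bigcup_{i\in\Gamma}\varphi_i(K)$. A self-similar measure associated to $\Phi$ is the unique Borel probability measure $\mu$ with $\mu=\sum_{i\in\Gamma}p_i\cdot\mu\circ\varphi_i^{-1}$ for some probability vector $(p_i)_{i\in\Gamma}$ with positive entries. Weak separation condition: $\Gamma^*=\bigcup_{n\ge1}\Gamma^n$ is the set of finite words. For $a=(i_0,\dots,i_n)\in\Gamma^*$ write $\varphi_a=\varphi_{i_0}\circ\cdots\circ\varphi_{i_n}$, $\rho_a=\rho_{i_0}\cdots\rho_{i_n}$, $K_a=\varphi_a(K)$, $a^-=(i_0,\dots,i_{n-1})$ (with $\rho_{a^-}=1$ if $a$ has length $1$). Fix a closed ball (interval) $B$ centred at a point of $K$ whose interior contains $K$, put $B_a=\varphi_a(B)$ and $$\mathcal{N}(a)=\{\varphi_a^{-1}\circ\varphi_b:\ b\in\Gamma^*,\ \rho_b\le\rho_a<\rho_{b^-},\ K_b\cap B_a\neq\emptyset\}.$$ $\Phi$ satisfies the weak separation condition if $\sup_{a\in\Gamma^*}\#\mathcal{N}(a)<\infty$.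 A real number $x$ is $s$-normal if the sequence $(s^kx \bmod 1)_{k\in\mathbb{N}}$ equidistributes for Lebesgue measure on $[0,1]$; a measure $\mu$ is pointwise $s$-normal if $\mu$-almost every $x$ is $s$-normal. A Pisot number is a real algebraic integer $>1$ all of whose other Galois conjugates have modulus $<1$.
   Formalization: The attractor K is additionally assumed not to be a single point; otherwise the claim fails, e.g. for x/3 and x/9 with K={0}, μ the point mass at 0 and s=2, since 0 is not 2-normal. *)

theory Defs
  imports "HOL-Probability.Probability" "HOL-Computational_Algebra.Computational_Algebra"
begin

text \<open>
  An iterated function system of similarities of the line, indexed by \<open>{1..m}\<close>, is given by its
  contraction ratios \<open>\<rho>\<close> and translations \<open>t\<close>; only the values on \<open>{1..m}\<close> matter.
\<close>

definition ifs_map :: "(nat \<Rightarrow> real) \<Rightarrow> (nat \<Rightarrow> real) \<Rightarrow> nat \<Rightarrow> real \<Rightarrow> real" where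
  "ifs_map \<rho> t i = (\<lambda>x. \<rho> i * x + t i)"

definition is_attractor ::
    "nat \<Rightarrow> (nat \<Rightarrow> real) \<Rightarrow> (nat \<Rightarrow> real) \<Rightarrow> real set \<Rightarrow> bool" where
  "is_attractor m \<rho> t K \<longleftrightarrow>
     K \<noteq> {} \<and> compact K \<and> K = (\<Union>i\<in>{1..m}. ifs_map \<rho> t i ` K)"

definition self_similar_measure ::
    "nat \<Rightarrow> (nat \<Rightarrow> real) \<Rightarrow> (nat \<Rightarrow> real) \<Rightarrow> real measure \<Rightarrow> bool" where
  "self_similar_measure m \<rho> t \<mu> \<longleftrightarrow>
     prob_space \<mu> \<and> sets \<mu> = sets borel \<and>
     (\<exists>p :: nat \<Rightarrow> real. (\<forall>i\<in>{1..m}. 0 < p i) \<and> (\<Sum>i=1..m. p i) = 1 \<and>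
        (\<forall>A\<in>sets borel.
           measure \<mu> A = (\<Sum>i=1..m. p i * measure \<mu> (ifs_map \<rho> t i -` A))))"

definition words :: "nat \<Rightarrow> nat list set" where
  "words m = {w. w \<noteq> [] \<and> set w \<subseteq> {1..m}}"

text \<open>The first letter of a word is the outermost map of the composition.\<close>

primrec word_map :: "(nat \<Rightarrow> real) \<Rightarrow> (nat \<Rightarrow> real) \<Rightarrow> nat list \<Rightarrow> real \<Rightarrow> real" where
  "word_map \<rho> t [] = id"
| "word_map \<rho> t (i # w) = ifs_map \<rho> t i \<circ> word_map \<rho> t w"

definition word_ratio :: "(nat \<Rightarrow> real) \<Rightarrow> nat list \<Rightarrow> real" where
  "word_ratio \<rho> w = prod_list (map \<rho> w)"

text \<open>
  The neighbour maps of the word \<open>a\<close>, relative to the attractor \<open>K\<close> and the ball \<open>B\<close>.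
  The parent of \<open>b\<close> is \<open>butlast b\<close>; when \<open>b\<close> has length one its ratio is the empty product 1.
\<close>

definition neighbour_maps ::
    "nat \<Rightarrow> (nat \<Rightarrow> real) \<Rightarrow> (nat \<Rightarrow> real) \<Rightarrow> real set \<Rightarrow> real set \<Rightarrow> nat list \<Rightarrow>
      (real \<Rightarrow> real) set" where
  "neighbour_maps m \<rho> t K B a =
     {inv (word_map \<rho> t a) \<circ> word_map \<rho> t b | b.
        b \<in> words m \<and> word_ratio \<rho> b \<le> word_ratio \<rho> a \<and>
        word_ratio \<rho> a < word_ratio \<rho> (butlast b) \<and>
        word_map \<rho> t b ` K \<inter> word_map \<rho> t a ` B \<noteq> {}}"

definition weak_separation ::
    "nat \<Rightarrow> (nat \<Rightarrow> real) \<Rightarrow> (nat \<Rightarrow> real) \<Rightarrow> real set \<Rightarrow> real set \<Rightarrow> bool" where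
  "weak_separation m \<rho> t K B \<longleftrightarrow>
     (\<exists>C. \<forall>a\<in>words m.
        finite (neighbour_maps m \<rho> t K B a) \<and> card (neighbour_maps m \<rho> t K B a) \<le> C)"

definition equidistributed_mod_1 :: "(nat \<Rightarrow> real) \<Rightarrow> bool" where
  "equidistributed_mod_1 x \<longleftrightarrow>
     (\<forall>u v. 0 \<le> u \<and> u < v \<and> v \<le> 1 \<longrightarrow>
        (\<lambda>N. real (card {k. k < N \<and> frac (x k) \<in> {u..<v}}) / real N) \<longlonglongrightarrow> v - u)"

definition normal_number :: "real \<Rightarrow> real \<Rightarrow> bool" where
  "normal_number s x \<longleftrightarrow> equidistributed_mod_1 (\<lambda>k. s ^ k * x)"

definition pointwise_normal :: "real \<Rightarrow> real measure \<Rightarrow> bool" where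
  "pointwise_normal s \<mu> \<longleftrightarrow> (AE x in \<mu>. normal_number s x)"

text \<open>
  An irreducible rational polynomial vanishing at \<open>s\<close> is, up to a nonzero scalar, the minimal
  polynomial of \<open>s\<close>.
\<close>

definition galois_conjugate :: "real \<Rightarrow> complex \<Rightarrow> bool" where
  "galois_conjugate s z \<longleftrightarrow>
     (\<exists>p :: rat poly. irreducible p \<and>
        poly (map_poly of_rat p) s = 0 \<and> poly (map_poly of_rat p) z = 0)"

definition pisot :: "real \<Rightarrow> bool" where
  "pisot s \<longleftrightarrow> 1 < s \<and> algebraic_int s \<and>
     (\<forall>z. galois_conjugate s z \<and> z \<noteq> complex_of_real s \<longrightarrow> cmod z < 1)"

end

theory Submission
  imports Defs
begin

text \<open>
  The orbit is followed by exponential sums over a random walk of scales. Let the letters of a random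
  word be independent with law \<open>p\<close>, let \<open>\<alpha> = - log s \<rho>\<close> and let \<open>A n\<close> be the sum of \<open>\<alpha>\<close> over the first
  \<open>n\<close> letters, so that the cylinder of level \<open>n\<close> has ratio \<open>s powr (- A n)\<close>. Split the times \<open>k\<close> into the
  blocks \<open>A n \<le> k < A (n + 1)\<close>. Given the first \<open>n + 1\<close> letters, the mean of \<open>e(\<kappa> s^(D + k) x)\<close> over
  a block is bounded by values of the Fourier transform of \<open>\<mu>\<close> at \<open>\<kappa> s powr (D - j - frac (A (n + 1)))\<close>,
  and the block sums minus these means are bounded with exponentially decaying correlations, so
  they average to \<open>0\<close> almost surely. By irrationality of \<open>log s / log \<rho>\<close>, \<open>A n\<close> equidistributes modulo 1,
  which turns the average of the means into an average of the Fourier transform over an interval of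
  scales; by Wiener's argument this tends to \<open>0\<close> as \<open>D\<close> grows, because \<open>\<mu>\<close> has no atoms.
\<close>

section \<open>Equidistribution modulo 1\<close>

text \<open>Scales are measured in powers of \<open>s\<close>, which is the reason for
  \<open>\<alpha>\<close>. A time in the block is \<open>\<lfloor>A (n + 1)\<rfloor> - j\<close> for
  some small \<open>j\<close>; multiplying its frequency by the cylinder ratio
  \<open>s powr (- A (n + 1))\<close> cancels the integer part of the walk. Only the fractional part
  survives, so equidistribution modulo 1 is all that has to be known about the walk. The obstacle is
  that a block sum depends on the whole word, so block sums minus conditional means are not adapted
  to the letters. Truncating the code after \<open>l + 1\<close> letters changes block
  \<open>n < l\<close> by at most a constant times \<open>r ^ (l - n)\<close>: the block oscillates
  at scale \<open>s powr A (n + 1)\<close>, and the truncation error is of size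
  \<open>s powr (- A (l + 1))\<close>. The shift \<open>D\<close> is free, because it only drops the
  first \<open>D\<close> terms of the orbit. The number of blocks tends to infinity with
  \<open>D\<close> fixed; \<open>D\<close> is chosen beforehand from the limiting value, and the
  countably many \<open>D\<close> share one null set. Everything is proved for the law of the coded
  point, which is identified with \<open>\<mu>\<close> through characteristic functions.\<close>

inductive trig_poly :: "(real \<Rightarrow> complex) \<Rightarrow> bool" where
  exp: "trig_poly (\<lambda>\<theta>. c * iexp (2 * pi * of_int q * \<theta>))"
| add: "trig_poly f \<Longrightarrow> trig_poly g \<Longrightarrow> trig_poly (\<lambda>\<theta>. f \<theta> + g \<theta>)"

lemma trig_poly_mult_exp:
  assumes "trig_poly f"
  shows "trig_poly (\<lambda>\<theta>. c * iexp (2 * pi * of_int q * \<theta>) * f \<theta>)"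
  using assms
proof (induction rule: trig_poly.induct)
  case (exp c' q')
  have "(\<lambda>\<theta>. c * iexp (2 * pi * of_int q * \<theta>) * (c' * iexp (2 * pi * of_int q' * \<theta>))) =
        (\<lambda>\<theta>. (c * c') * iexp (2 * pi * of_int (q + q') * \<theta>))"
    by (rule ext) (simp add: ring_distribs exp_add)
  then show ?case using trig_poly.exp[of "c * c'" "q + q'"] by metis
next
  case (add f g)
  then show ?case using trig_poly.add by (simp add: distrib_left)
qed

lemma trig_poly_mult:
  assumes "trig_poly f" "trig_poly g"
  shows "trig_poly (\<lambda>\<theta>. f \<theta> * g \<theta>)"
  using assms(1)
proof (induction rule: trig_poly.induct)
  case (exp c q)
  then show ?case using trig_poly_mult_exp[OF assms(2)] by simp
next
  case (add f h)
  then show ?case using trig_poly.add by (simp add: distrib_right)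
qed

lemma trig_poly_const: "trig_poly (\<lambda>_. c)"
  using trig_poly.exp[of c 0] by simp

text \<open>Stone-Weierstrass will supply real polynomials in the two coordinates of the plane. On
  the circle the coordinates are cosine and sine, and products stay trigonometric.\<close>

lemma trig_poly_real_polynomial:
  assumes "real_polynomial_function g"
  shows "trig_poly (\<lambda>\<theta>. complex_of_real (g (cis (2 * pi * \<theta>))))"
  using assms
proof (induction rule: real_polynomial_function.induct)
  case (linear g)
  interpret bounded_linear g by fact
  have g: "g z = Re z * g 1 + Im z * g \<i>" for z
  proof -
    have "z = Re z *\<^sub>R 1 + Im z *\<^sub>R \<i>" by (simp add: complex_eq_iff)
    then have "g z = g (Re z *\<^sub>R 1 + Im z *\<^sub>R \<i>)" by simp
    then show ?thesis unfolding add scaleR by simp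
  qed
  \<comment> \<open>Coefficients of \<open>g 1 * cos + g \<i> * sin\<close> after inserting Euler's
    formulas.\<close>
  let ?a = "(g 1 - \<i> * g \<i>) / 2" and ?b = "(g 1 + \<i> * g \<i>) / 2"
  have e: "complex_of_real (g (cis (2 * pi * \<theta>))) =
      ?a * iexp (2 * pi * of_int 1 * \<theta>) + ?b * iexp (2 * pi * of_int (- 1) * \<theta>)" for \<theta>
    unfolding cis_conv_exp[symmetric] by (subst g) (simp add: complex_eq_iff field_simps)
  show ?case unfolding e by (intro trig_poly.add trig_poly.exp)
next
  case (const c)
  then show ?case by (rule trig_poly_const)
next
  case (add f g)
  then show ?case using trig_poly.add by simp
next
  case (mult f g)
  then show ?case using trig_poly_mult by simp
qed

section \<open>Weyl's criterion\<close>

definition vanishing_weyl_sums :: "(nat \<Rightarrow> real) \<Rightarrow> bool" where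
  "vanishing_weyl_sums x \<longleftrightarrow>
     (\<forall>q::int. q \<noteq> 0 \<longrightarrow> (\<lambda>N. (\<Sum>k<N. iexp (2 * pi * of_int q * x k)) / of_nat N) \<longlonglongrightarrow> 0)"

lemma has_integral_iexp:
  assumes "q \<noteq> 0"
  shows "((\<lambda>\<theta>. iexp (2 * pi * of_int q * \<theta>)) has_integral 0) {0..1}"
proof -
  let ?F = "\<lambda>\<theta>::real. iexp (2 * pi * of_int q * \<theta>) / (2 * pi * of_int q * \<i>)"
  have "((\<lambda>\<theta>. iexp (2 * pi * of_int q * \<theta>)) has_integral ?F 1 - ?F 0) {0..1}"
  proof (rule fundamental_theorem_of_calculus)
    fix x :: real
    have "((\<lambda>z. exp (\<i> * (2 * pi * of_int q * z)) / (2 * pi * of_int q * \<i>))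
        has_field_derivative exp (\<i> * (2 * pi * of_int q * of_real x))) (at (of_real x))"
      using assms by (auto intro!: derivative_eq_intros simp: field_simps)
    from has_vector_derivative_real_field[OF this]
    show "(?F has_vector_derivative iexp (2 * pi * of_int q * x)) (at x within {0..1})"
      by (simp add: mult.assoc has_vector_derivative_at_within)
  qed simp
  moreover have "iexp (2 * pi * of_int q) = 1"
    by (subst exp_eq_1) (auto intro!: exI[of _ q])
  ultimately show ?thesis by simp
qed

text \<open>A nonzero frequency has limit and integral 0, the zero frequency contributes its
  coefficient to both. Keeping \<open>I\<close> existential lets the induction run without a formula
  for the constant coefficient.\<close>

lemma trig_poly_average:
  assumes "trig_poly f" "vanishing_weyl_sums x"
  shows "\<exists>I. (f has_integral I) {0..1} \<and> (\<lambda>N. (\<Sum>k<N. f (x k)) / of_nat N) \<longlonglongrightarrow> I"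
  using assms(1)
proof (induction rule: trig_poly.induct)
  case (exp c q)
  show ?case
  proof (cases "q = 0")
    case True
    have "(\<lambda>N. (\<Sum>k<N. c) / of_nat N) \<longlonglongrightarrow> c"
      by (rule tendsto_eventually, rule eventually_mono[OF eventually_gt_at_top[of 0]]) auto
    then show ?thesis using True has_integral_const_real[of c 0 1] by auto
  next
    case False
    have "(\<lambda>N. c * ((\<Sum>k<N. iexp (2 * pi * of_int q * x k)) / of_nat N)) \<longlonglongrightarrow> c * 0"
      using assms(2) False unfolding vanishing_weyl_sums_def by (intro tendsto_intros) auto
    then show ?thesis
      using has_integral_mult_right[OF has_integral_iexp[OF False], of c]
      by (intro exI[of _ 0]) (simp add: sum_distrib_left)
  qed
next
  case (add f g)
  then obtain I J where "(f has_integral I) {0..1}" "(\<lambda>N. (\<Sum>k<N. f (x k)) / of_nat N) \<longlonglongrightarrow> I"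
    "(g has_integral J) {0..1}" "(\<lambda>N. (\<Sum>k<N. g (x k)) / of_nat N) \<longlonglongrightarrow> J" by blast
  then show ?case
    by (intro exI[of _ "I + J"]) (auto simp: sum.distrib add_divide_distrib
      intro: has_integral_add tendsto_add)
qed

lemma norm_average_le:
  fixes f :: "nat \<Rightarrow> 'a::real_normed_field"
  assumes "\<And>k. norm (f k) \<le> B" "B \<ge> 0"
  shows "norm ((\<Sum>k<N. f k) / of_nat N) \<le> B"
proof (cases "N = 0")
  case False
  have "norm (\<Sum>k<N. f k) \<le> (\<Sum>k<N. B)" using assms by (intro sum_norm_le) auto
  then show ?thesis using False by (simp add: norm_divide field_simps)
qed (use assms in auto)

text \<open>Stating this on the circle builds periodicity into \<open>H\<close>, so polynomial
  approximation is available. Replacing \<open>H\<close> by a polynomial within \<open>e / 4\<close>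
  moves the average and the integral by at most \<open>e / 4\<close> each.\<close>

lemma weyl_average_circle:
  fixes H :: "complex \<Rightarrow> real"
  assumes x: "vanishing_weyl_sums x" and H: "continuous_on (sphere 0 1) H"
  shows "(\<lambda>N. (\<Sum>k<N. H (cis (2 * pi * x k))) / real N) \<longlonglongrightarrow>
           integral {0..1} (\<lambda>\<theta>. H (cis (2 * pi * \<theta>)))"
proof (rule LIMSEQ_I)
  fix e :: real assume "0 < e"
  then obtain g where g: "real_polynomial_function g"
    and Hg: "\<And>z. z \<in> sphere 0 1 \<Longrightarrow> \<bar>H z - g z\<bar> < e / 4"
    using Stone_Weierstrass_real_polynomial_function[OF compact_sphere H, of "e / 4"] by auto
  from trig_poly_average[OF trig_poly_real_polynomial[OF g] x] obtain I where
    I: "((\<lambda>\<theta>. complex_of_real (g (cis (2 * pi * \<theta>)))) has_integral I) {0..1}" and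
    lim: "(\<lambda>N. (\<Sum>k<N. complex_of_real (g (cis (2 * pi * x k)))) / of_nat N) \<longlonglongrightarrow> I" by blast
  have I': "((\<lambda>\<theta>. g (cis (2 * pi * \<theta>))) has_integral Re I) {0..1}"
    using has_integral_Re[OF I] by simp
  have lim': "(\<lambda>N. (\<Sum>k<N. g (cis (2 * pi * x k))) / real N) \<longlonglongrightarrow> Re I"
  proof -
    have "Re ((\<Sum>k<N. complex_of_real (g (cis (2 * pi * x k)))) / of_nat N) =
        (\<Sum>k<N. g (cis (2 * pi * x k))) / real N" for N
      by (simp add: Re_divide_of_nat)
    then show ?thesis using tendsto_Re[OF lim] by simp
  qed
  have "continuous_on {0..1} (\<lambda>\<theta>. H (cis (2 * pi * \<theta>)))"
    by (rule continuous_on_compose2[OF H]) (auto intro!: continuous_intros)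
  then have "((\<lambda>\<theta>. H (cis (2 * pi * \<theta>))) has_integral
      integral {0..1} (\<lambda>\<theta>. H (cis (2 * pi * \<theta>)))) {0..1}"
    by (simp add: integrable_continuous_real integrable_integral)
  from has_integral_diff[OF this I'] have
    "norm (integral {0..1} (\<lambda>\<theta>. H (cis (2 * pi * \<theta>))) - Re I) \<le> e / 4 * measure lborel {0..1::real}"
    using Hg \<open>0 < e\<close> by (intro has_integral_bound_real[where f = "\<lambda>\<theta>. H (cis (2 * pi * \<theta>)) - g (cis (2 * pi * \<theta>))"])
      (auto intro!: less_imp_le)
  then have 1: "\<bar>integral {0..1} (\<lambda>\<theta>. H (cis (2 * pi * \<theta>))) - Re I\<bar> \<le> e / 4" by simp
  from LIMSEQ_D[OF lim', of "e / 4"] \<open>0 < e\<close> obtain N0 where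
    2: "\<And>N. N \<ge> N0 \<Longrightarrow> \<bar>(\<Sum>k<N. g (cis (2 * pi * x k))) / real N - Re I\<bar> < e / 4" by auto
  show "\<exists>N0. \<forall>N\<ge>N0. norm ((\<Sum>k<N. H (cis (2 * pi * x k))) / real N -
      integral {0..1} (\<lambda>\<theta>. H (cis (2 * pi * \<theta>)))) < e"
  proof (intro exI allI impI)
    fix N assume N: "N \<ge> N0"
    have "norm ((\<Sum>k<N. H (cis (2 * pi * x k)) - g (cis (2 * pi * x k))) / real N) \<le> e / 4"
      using Hg \<open>0 < e\<close> by (intro norm_average_le) (auto intro!: less_imp_le)
    then have 3: "\<bar>(\<Sum>k<N. H (cis (2 * pi * x k))) / real N - (\<Sum>k<N. g (cis (2 * pi * x k))) / real N\<bar> \<le> e / 4"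
      by (simp add: sum_subtractf diff_divide_distrib)
    show "norm ((\<Sum>k<N. H (cis (2 * pi * x k))) / real N -
      integral {0..1} (\<lambda>\<theta>. H (cis (2 * pi * \<theta>)))) < e"
      using 1 2[OF N] 3 \<open>0 < e\<close> unfolding real_norm_def by linarith
  qed
qed

text \<open>The parametrisation of the circle by \<open>{0..1}\<close> is injective up to the gluing
  of 0 and 1; the exception will be a finite set in an integral.\<close>

lemma cis_eq_cis_mod_1:
  assumes "cis (2 * pi * a) = cis (2 * pi * b)" "a \<in> {0..1}" "b \<in> {0..1}"
  shows "a = b \<or> b \<in> {0, 1}"
proof -
  have "sin (2 * pi * a) = sin (2 * pi * b)" "cos (2 * pi * a) = cos (2 * pi * b)"
    using assms(1) by (auto simp: complex_eq_iff)
  from this[THEN sym] obtain n :: int where "2 * pi * b = 2 * pi * a + 2 * pi * of_int n"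
    using sin_cos_eq_iff[of "2 * pi * b" "2 * pi * a"] by (auto simp: mult_ac)
  then have "2 * pi * b = 2 * pi * (a + of_int n)" by (simp add: algebra_simps)
  then have n: "b = a + of_int n" by simp
  with assms have "of_int n \<le> (1::real)" "of_int n \<ge> (-1::real)" by auto
  then have "n = -1 \<or> n = 0 \<or> n = 1" by linarith
  then show ?thesis using n assms by auto
qed

lemma cis_frac: "cis (2 * pi * frac y) = cis (2 * pi * y)"
proof -
  have "iexp (2 * pi * of_int \<lfloor>y\<rfloor>) = 1"
    by (subst exp_eq_1) (auto intro!: exI[of _ "\<lfloor>y\<rfloor>"])
  then have "cis (2 * pi * of_int \<lfloor>y\<rfloor>) = 1" by (simp add: cis_conv_exp)
  moreover have "2 * pi * y = 2 * pi * frac y + 2 * pi * of_int \<lfloor>y\<rfloor>"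
    by (simp add: frac_def algebra_simps)
  ultimately show ?thesis by (metis cis_mult mult.right_neutral)
qed

lemma frequency_eq_average:
  "real (card {k. k < N \<and> frac (x k) \<in> A}) / real N = (\<Sum>k<N. indicator A (frac (x k))) / real N"
proof -
  have "(\<Sum>k<N. indicator A (frac (x k))) = real (card {k \<in> {..<N}. frac (x k) \<in> A})"
    by (subst sum.mono_neutral_right[of _ "{k \<in> {..<N}. frac (x k) \<in> A}"]) auto
  then show ?thesis by simp
qed

lemma weyl_frequency_upper:
  assumes x: "vanishing_weyl_sums x" and uv: "0 \<le> u" "u \<le> v" "v \<le> 1" and "0 < e"
  shows "\<forall>\<^sub>F N in sequentially.
    real (card {k. k < N \<and> frac (x k) \<in> {u..<v}}) / real N < v - u + e"
proof -
  define arc where "arc = (\<lambda>\<theta>. cis (2 * pi * \<theta>)) ` {u..v}"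
  have "compact arc" unfolding arc_def
    by (intro compact_continuous_image continuous_intros) auto
  then have arc: "closed arc" "arc \<noteq> {}"
    using uv by (auto simp: compact_imp_closed arc_def)
  \<comment> \<open>Cut-off with value 1 on the arc, and 0 from distance \<open>1 / j\<close> on
    when \<open>j > 0\<close>; it decreases to the indicator because the arc is closed.\<close>
  define H where "H = (\<lambda>(j::nat) z. max 0 (1 - real j * infdist z arc))"
  have contH: "continuous_on S (H j)" for j S
    unfolding H_def by (intro continuous_intros)
  have H01: "0 \<le> H j z" "H j z \<le> 1" for j z
    by (auto simp: H_def infdist_nonneg)
  have Harc: "H j z = 1" if "z \<in> arc" for j z
    using that by (simp add: H_def)
  have limH: "(\<lambda>j. H j z) \<longlonglongrightarrow> indicator arc z" for z
  proof (cases "z \<in> arc")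
    case False
    then have d: "infdist z arc > 0"
      using arc by (metis in_closed_iff_infdist_zero infdist_nonneg less_eq_real_def)
    have "\<forall>\<^sub>F j in sequentially. real j \<ge> 1 / infdist z arc"
      by (metis eventually_sequentiallyI nat_ceiling_le_eq)
    then have "\<forall>\<^sub>F j in sequentially. H j z = 0"
      by eventually_elim (use d in \<open>auto simp: H_def field_simps\<close>)
    with False show ?thesis by (simp add: tendsto_eventually)
  qed (simp add: Harc)
  have contI: "(\<lambda>\<theta>. H j (cis (2 * pi * \<theta>))) integrable_on {0..1}" for j
    by (intro integrable_continuous_real continuous_on_compose2[OF contH[of UNIV j]] continuous_intros) auto
  have "(\<lambda>j. integral {0..1} (\<lambda>\<theta>. H j (cis (2 * pi * \<theta>)))) \<longlonglongrightarrow>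
      integral {0..1} (\<lambda>\<theta>. indicator arc (cis (2 * pi * \<theta>)))"
    by (rule dominated_convergence[where h = "\<lambda>_. 1"]) (use contI limH H01 in auto)
  also have "integral {0..1} (\<lambda>\<theta>. indicator arc (cis (2 * pi * \<theta>))) = v - u"
  proof (rule integral_unique)
    have "((\<lambda>_. 1) has_integral (v - u)) {u..v}"
      using has_integral_const_real[of "1::real" u v] uv by simp
    then have "((\<lambda>\<theta>. indicator {u..v} \<theta> :: real) has_integral (v - u)) {0..1}"
      using has_integral_restrict[of "{u..v}" "{0..1}" "\<lambda>_. 1::real" "v - u"] uv
      by (simp add: indicator_def of_bool_def)
    then show "((\<lambda>\<theta>. indicator arc (cis (2 * pi * \<theta>)) :: real) has_integral (v - u)) {0..1}"
    \<comment> \<open>0 and 1 give the same point of the circle, so one of them may be mapped into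
      the arc from outside \<open>{u..v}\<close>.\<close>
    proof (rule has_integral_spike_finite[rotated 2, of _ _ _ "{0, 1}"])
      fix \<theta> :: real assume \<theta>: "\<theta> \<in> {0..1} - {0, 1}"
      have "cis (2 * pi * \<theta>) \<in> arc \<longleftrightarrow> \<theta> \<in> {u..v}"
      proof
        assume "cis (2 * pi * \<theta>) \<in> arc"
        then obtain a where "a \<in> {u..v}" "cis (2 * pi * a) = cis (2 * pi * \<theta>)"
          by (auto simp: arc_def)
        with cis_eq_cis_mod_1[of a \<theta>] \<theta> uv show "\<theta> \<in> {u..v}" by auto
      qed (auto simp: arc_def)
      then show "indicator arc (cis (2 * pi * \<theta>)) = (indicator {u..v} \<theta> :: real)"
        by (simp add: indicator_def)
    qed simp
  qed
  finally have "\<forall>\<^sub>F j in sequentially. integral {0..1} (\<lambda>\<theta>. H j (cis (2 * pi * \<theta>))) < v - u + e"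
    by (rule order_tendstoD) (use \<open>0 < e\<close> in simp)
  then obtain j where j: "integral {0..1} (\<lambda>\<theta>. H j (cis (2 * pi * \<theta>))) < v - u + e"
    by (auto simp: eventually_sequentially)
  from order_tendstoD(2)[OF weyl_average_circle[OF x contH] j] show ?thesis
  proof eventually_elim
    case (elim N)
    have "indicator {u..<v} (frac (x k)) \<le> H j (cis (2 * pi * x k))" for k
    proof (cases "frac (x k) \<in> {u..<v}")
      case True
      then have "cis (2 * pi * frac (x k)) \<in> arc" by (auto simp: arc_def)
      then show ?thesis by (simp add: cis_frac Harc)
    qed (simp add: H01)
    then have "(\<Sum>k<N. indicator {u..<v} (frac (x k))) / real N \<le> (\<Sum>k<N. H j (cis (2 * pi * x k))) / real N"
      by (intro divide_right_mono sum_mono) auto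
    with elim show ?case unfolding frequency_eq_average by linarith
  qed
qed

theorem weyl_criterion:
  assumes x: "vanishing_weyl_sums x"
  shows "equidistributed_mod_1 x"
  unfolding equidistributed_mod_1_def
proof (intro allI impI)
  fix u v :: real assume uv: "0 \<le> u \<and> u < v \<and> v \<le> 1"
  define F where "F A N = real (card {k. k < N \<and> frac (x k) \<in> A}) / real N" for A N
  have total: "F {0..<u} N + F {u..<v} N + F {v..<1} N = 1" if "N > 0" for N
  proof -
    have "indicator {0..<u} (frac y) + indicator {u..<v} (frac y) + indicator {v..<1} (frac y) = (1::real)" for y :: real
      using uv frac_ge_0[of y] frac_lt_1[of y] by (auto simp: indicator_def)
    then have "(\<Sum>k<N. indicator {0..<u} (frac (x k)) + indicator {u..<v} (frac (x k)) + indicator {v..<1} (frac (x k))) = real N"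
      by simp
    then show ?thesis using that
      unfolding F_def frequency_eq_average by (simp add: sum.distrib flip: add_divide_distrib)
  qed
  have "F {u..<v} \<longlonglongrightarrow> v - u"
  proof (rule order_tendstoI)
    fix a assume a: "v - u < a"
    show "\<forall>\<^sub>F N in sequentially. F {u..<v} N < a"
      using weyl_frequency_upper[OF x, of u v "a - (v - u)"] uv a unfolding F_def by simp
  next
    fix a assume a: "a < v - u"
    \<comment> \<open>Half of the gap, as two complementary intervals may each exceed their length
      by \<open>e\<close>.\<close>
    define e where "e = (v - u - a) / 2"
    have "e > 0" using a by (simp add: e_def)
    have "\<forall>\<^sub>F N in sequentially. F {0..<u} N < u - 0 + e" "\<forall>\<^sub>F N in sequentially. F {v..<1} N < 1 - v + e"
      using weyl_frequency_upper[OF x _ _ _ \<open>e > 0\<close>, of 0 u]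
        weyl_frequency_upper[OF x _ _ _ \<open>e > 0\<close>, of v 1] uv unfolding F_def by linarith+
    then show "\<forall>\<^sub>F N in sequentially. a < F {u..<v} N"
      using eventually_gt_at_top[of 0]
    proof eventually_elim
      case (elim N)
      have "2 * e = v - u - a" by (simp add: e_def)
      with total[of N] elim show ?case by linarith
    qed
  qed
  then show "(\<lambda>N. real (card {k. k < N \<and> frac (x k) \<in> {u..<v}}) / real N) \<longlonglongrightarrow> v - u"
    unfolding F_def .
qed

text \<open>The integrand needed later, \<open>cos (a * s powr (-\<theta>))\<close>, need not agree
  at 0 and 1, so the circle version does not apply. Step functions on half-open intervals fit the
  definition of equidistribution directly.\<close>

lemma equidistributed_average:
  fixes h :: "real \<Rightarrow> real"
  assumes x: "equidistributed_mod_1 x" and h: "continuous_on {0..1} h"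
  shows "(\<lambda>N. (\<Sum>k<N. h (frac (x k))) / real N) \<longlonglongrightarrow> integral {0..1} h"
proof (rule LIMSEQ_I)
  fix e :: real assume "0 < e"
  then obtain d where "d > 0" and d: "\<And>a b. a \<in> {0..1} \<Longrightarrow> b \<in> {0..1} \<Longrightarrow> \<bar>b - a\<bar> < d \<Longrightarrow> \<bar>h b - h a\<bar> < e / 4"
    using compact_uniformly_continuous[OF h] unfolding uniformly_continuous_on_def dist_real_def
    by (metis compact_Icc divide_pos_pos zero_less_numeral)
  obtain Q :: nat where Q: "Q > 0" "1 / real Q < d"
    using \<open>d > 0\<close> by (metis nat_approx_posE of_nat_Suc zero_less_Suc)
  define I where "I i = {real i / real Q..<real (Suc i) / real Q}" for i
  define st where "st \<theta> = (\<Sum>i<Q. h (real i / real Q) * indicator (I i) \<theta>)" for \<theta>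
  have st: "\<bar>h \<theta> - st \<theta>\<bar> \<le> e / 4" if \<theta>: "\<theta> \<in> {0..<1}" for \<theta>
  proof -
    define i where "i = nat \<lfloor>\<theta> * real Q\<rfloor>"
    have i: "real i \<le> \<theta> * real Q" "\<theta> * real Q < real i + 1"
      using \<theta> by (auto simp: i_def)
    have "real i < real Q"
      by (rule le_less_trans[OF i(1)]) (use \<theta> Q in auto)
    then have "i < Q" by simp
    have mem: "\<theta> \<in> I k \<longleftrightarrow> k = i" for k
    proof
      assume "\<theta> \<in> I k"
      then have "real k \<le> \<theta> * real Q" "\<theta> * real Q < real k + 1"
        using Q by (auto simp: I_def field_simps)
      with i have "real k < real i + 1" "real i < real k + 1" by linarith+
      then show "k = i" by linarith
    qed (use i Q in \<open>auto simp: I_def field_simps\<close>)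
    have "st \<theta> = (\<Sum>k<Q. if k = i then h (real i / real Q) else 0)"
      unfolding st_def by (intro sum.cong) (auto simp: mem indicator_def)
    also have "\<dots> = h (real i / real Q)" using \<open>i < Q\<close> by simp
    finally have "st \<theta> = h (real i / real Q)" .
    moreover have "\<bar>h \<theta> - h (real i / real Q)\<bar> < e / 4"
    proof (rule d)
      have "\<bar>\<theta> - real i / real Q\<bar> \<le> 1 / real Q"
      proof -
        have "\<theta> - real i / real Q = (\<theta> * real Q - real i) / real Q" using Q by (simp add: field_simps)
        then show ?thesis using i Q by (auto simp: abs_of_nonneg intro!: divide_right_mono)
      qed
      then show "\<bar>\<theta> - real i / real Q\<bar> < d" using Q by simp
    qed (use \<theta> \<open>i < Q\<close> in auto)
    ultimately show ?thesis by simp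
  qed
  define L where "L = (\<Sum>i<Q. h (real i / real Q) * (1 / real Q))"
  have len: "real (Suc i) / real Q - real i / real Q = 1 / real Q" for i
    by (simp add: add_divide_distrib)
  have "((\<lambda>\<theta>. st \<theta>) has_integral L) {0..1}"
    unfolding st_def L_def
  proof (intro has_integral_sum has_integral_mult_right)
    fix i assume i: "i \<in> {..<Q}"
    have sub: "{real i / real Q..real (Suc i) / real Q} \<subseteq> {0..1}"
      using i Q by (auto simp: field_simps intro: order_trans)
    have "((\<lambda>_. 1::real) has_integral (1 / real Q)) {real i / real Q..real (Suc i) / real Q}"
      using has_integral_const_real[of "1::real" "real i / real Q" "real (Suc i) / real Q"] len[of i] Q
      by (simp add: divide_right_mono)
    then have "((\<lambda>\<theta>. if \<theta> \<in> {real i / real Q..real (Suc i) / real Q} then 1 else 0 :: real) has_integral (1 / real Q)) {0..1}"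
      unfolding has_integral_restrict[OF sub] .
    then show "((\<lambda>\<theta>. indicator (I i) \<theta> :: real) has_integral (1 / real Q)) {0..1}"
      by (rule has_integral_spike_finite[rotated 2, of _ _ _ "{real (Suc i) / real Q}"])
        (auto simp: I_def indicator_def)
  qed simp
  moreover have "(h has_integral integral {0..1} h) {0..1}"
    using h by (simp add: integrable_continuous_real integrable_integral)
  ultimately have "((\<lambda>\<theta>. h \<theta> - st \<theta>) has_integral (integral {0..1} h - L)) {0..1}"
    by (intro has_integral_diff) auto
  \<comment> \<open>The half-open intervals miss the point 1, where the step function is 0; hence
    the exceptional set.\<close>
  from has_integral_bound_real[of "e / 4" "{1}", OF _ _ this] st \<open>0 < e\<close>
  have 1: "\<bar>integral {0..1} h - L\<bar> \<le> e / 4" by auto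
  have "(\<lambda>N. (\<Sum>k<N. indicator (I i) (frac (x k))) / real N) \<longlonglongrightarrow> 1 / real Q" if "i < Q" for i
  proof -
    have "0 \<le> real i / real Q" "real i / real Q < real (Suc i) / real Q" "real (Suc i) / real Q \<le> 1"
      using that Q by (auto simp: divide_strict_right_mono)
    with x len[of i] show ?thesis unfolding equidistributed_mod_1_def I_def frequency_eq_average
      by metis
  qed
  then have "(\<lambda>N. \<Sum>i<Q. h (real i / real Q) * ((\<Sum>k<N. indicator (I i) (frac (x k))) / real N)) \<longlonglongrightarrow> L"
    unfolding L_def by (intro tendsto_sum tendsto_mult_left) simp
  moreover have "(\<Sum>i<Q. h (real i / real Q) * ((\<Sum>k<N. indicator (I i) (frac (x k))) / real N)) =
      (\<Sum>k<N. st (frac (x k))) / real N" for N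
    unfolding st_def sum_distrib_left sum_divide_distrib times_divide_eq_right by (rule sum.swap)
  ultimately have "(\<lambda>N. (\<Sum>k<N. st (frac (x k))) / real N) \<longlonglongrightarrow> L" by simp
  from LIMSEQ_D[OF this, of "e / 4"] \<open>0 < e\<close> obtain N0 where
    2: "\<And>N. N \<ge> N0 \<Longrightarrow> \<bar>(\<Sum>k<N. st (frac (x k))) / real N - L\<bar> < e / 4" by auto
  show "\<exists>N0. \<forall>N\<ge>N0. norm ((\<Sum>k<N. h (frac (x k))) / real N - integral {0..1} h) < e"
  proof (intro exI allI impI)
    fix N assume N: "N \<ge> N0"
    have "norm ((\<Sum>k<N. h (frac (x k)) - st (frac (x k))) / real N) \<le> e / 4"
      using st \<open>0 < e\<close> by (intro norm_average_le) (auto simp: frac_lt_1)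
    then have 3: "\<bar>(\<Sum>k<N. h (frac (x k))) / real N - (\<Sum>k<N. st (frac (x k))) / real N\<bar> \<le> e / 4"
      by (simp add: sum_subtractf diff_divide_distrib)
    show "norm ((\<Sum>k<N. h (frac (x k))) / real N - integral {0..1} h) < e"
      using 1 2[OF N] 3 \<open>0 < e\<close> unfolding real_norm_def by linarith
  qed
qed

section \<open>A strong law of large numbers\<close>

lemma borel_measurable_cnj [measurable (raw)]:
  "f \<in> borel_measurable M \<Longrightarrow> (\<lambda>x. cnj (f x)) \<in> borel_measurable M"
  by (rule measurable_compose[OF _ borel_measurable_continuous_onI]) (auto intro!: continuous_intros)

lemma (in prob_space) norm_expectation_le:
  fixes f :: "'a \<Rightarrow> 'b::{banach, second_countable_topology}"
  assumes "\<And>x. norm (f x) \<le> B"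
  shows "norm (expectation f) \<le> B"
proof -
  have "expectation (\<lambda>x. norm (f x)) \<le> B"
  proof (cases "integrable M (\<lambda>x. norm (f x))")
    case True
    then show ?thesis by (rule integral_le_const) (simp add: assms)
  next
    \<comment> \<open>The integral then has its default value 0, and \<open>B\<close> is nonnegative
      because it bounds a norm.\<close>
    case False
    then show ?thesis using order_trans[OF norm_ge_zero assms] by (simp add: not_integrable_integral_eq)
  qed
  then show ?thesis by (rule order_trans[OF integral_norm_bound])
qed

text \<open>Second moments of order \<open>1 / N\<close> are summable only along squares. Between
  consecutive squares there are at most \<open>2 * j\<close> further terms, each bounded by
  \<open>B\<close>, which is negligible against \<open>j\<^sup>2\<close>.\<close>

lemma average_tendsto_0_if_squares:
  fixes f :: "nat \<Rightarrow> complex"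
  assumes f: "\<And>k. norm (f k) \<le> B"
    and sq: "(\<lambda>j. (\<Sum>k<(Suc j)\<^sup>2. f k) / of_nat ((Suc j)\<^sup>2)) \<longlonglongrightarrow> 0"
  shows "(\<lambda>N. (\<Sum>k<N. f k) / of_nat N) \<longlonglongrightarrow> 0"
proof -
  define v where "v j = norm ((\<Sum>k<j\<^sup>2. f k) / of_nat (j\<^sup>2))" for j :: nat
  have "(\<lambda>j. v (Suc j)) \<longlonglongrightarrow> 0"
    unfolding v_def by (intro tendsto_norm_zero sq)
  then have v: "v \<longlonglongrightarrow> 0" by (simp only: filterlim_sequentially_Suc)
  define g where "g N = nat \<lfloor>sqrt (real N)\<rfloor>" for N
  have g: "filterlim g at_top sequentially"
    unfolding g_def
    by (rule filterlim_compose[OF filterlim_nat_sequentially])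
      (rule filterlim_compose[OF filterlim_floor_sequentially],
        rule filterlim_compose[OF sqrt_at_top filterlim_real_sequentially])
  have B: "B \<ge> 0" using f[of 0] norm_ge_zero order_trans by blast
  have bound: "norm ((\<Sum>k<N. f k) / of_nat N) \<le> v (g N) + 2 * B / real (g N)" if "N > 0" for N
  proof -
    let ?j = "g N"
    have j: "real ?j \<le> sqrt (real N)" "sqrt (real N) < real ?j + 1" and j0: "?j \<noteq> 0"
      using that by (auto simp: g_def le_nat_floor)
    have "(real ?j)\<^sup>2 \<le> real N"
      using power_mono[OF j(1), of 2] by simp
    then have le: "?j\<^sup>2 \<le> N" by (simp flip: of_nat_power)
    have "real N < (real ?j + 1)\<^sup>2"
      using power_strict_mono[OF j(2), of 2] by simp
    then have "real N \<le> real (?j\<^sup>2 + 2 * ?j)"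
      by (simp add: power2_eq_square algebra_simps flip: of_nat_power of_nat_mult of_nat_add)
    then have len: "real N - real (?j\<^sup>2) \<le> 2 * real ?j" by simp
    have "(\<Sum>k<N. f k) = (\<Sum>k<?j\<^sup>2. f k) + (\<Sum>k\<in>{?j\<^sup>2..<N}. f k)"
      using le by (metis lessThan_atLeast0 sum.atLeastLessThan_concat zero_le)
    moreover have "norm (\<Sum>k\<in>{?j\<^sup>2..<N}. f k) \<le> real (card {?j\<^sup>2..<N}) * B"
      using f by (intro sum_norm_bound) auto
    moreover have "real (card {?j\<^sup>2..<N}) * B \<le> (2 * real ?j) * B"
      using len le B by (intro mult_right_mono) (simp_all add: of_nat_diff)
    ultimately have "norm (\<Sum>k<N. f k) \<le> norm (\<Sum>k<?j\<^sup>2. f k) + 2 * real ?j * B"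
      using norm_triangle_ineq[of "\<Sum>k<?j\<^sup>2. f k" "\<Sum>k\<in>{?j\<^sup>2..<N}. f k"] by simp
    then have "norm (\<Sum>k<N. f k) / real N \<le> (norm (\<Sum>k<?j\<^sup>2. f k) + 2 * real ?j * B) / real (?j\<^sup>2)"
      using le j0 B that by (intro frac_le) (auto simp flip: of_nat_power)
    also have "\<dots> = v ?j + 2 * B / real ?j"
      using j0 by (simp add: v_def norm_divide norm_power norm_mult add_divide_distrib power2_eq_square)
    finally show ?thesis by (simp add: norm_divide)
  qed
  have "(\<lambda>N. v (g N) + 2 * B / real (g N)) \<longlonglongrightarrow> 0 + 0"
    by (intro tendsto_add filterlim_compose[OF v g] real_tendsto_divide_at_top[OF tendsto_const]
      filterlim_compose[OF filterlim_real_sequentially g])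
  then have "(\<lambda>N. v (g N) + 2 * B / real (g N)) \<longlonglongrightarrow> 0" by simp
  then show ?thesis
    by (rule Lim_null_comparison[rotated])
      (use bound in \<open>auto intro!: eventually_mono[OF eventually_gt_at_top[of 0]]\<close>)
qed

lemma sum_geometric_le:
  fixes r :: real
  assumes "0 \<le> r" "r < 1"
  shows "(\<Sum>i<n. r ^ i) \<le> 1 / (1 - r)"
  using assms by (subst sum_gp_strict) (auto simp: divide_right_mono)

text \<open>With truncated subtraction the exponent is the distance between \<open>l\<close> and
  \<open>n\<close>; each side of \<open>n\<close> contributes a geometric series.\<close>

lemma sum_geometric_distance_le:
  fixes r :: real
  assumes r: "0 \<le> r" "r < 1" and "n < N"
  shows "(\<Sum>l<N. r ^ ((l - n) + (n - l))) \<le> 2 / (1 - r)"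
proof -
  have "(\<Sum>l<N. r ^ ((l - n) + (n - l))) =
      (\<Sum>l<n. r ^ ((l - n) + (n - l))) + (\<Sum>l\<in>{n..<N}. r ^ ((l - n) + (n - l)))"
    using sum.atLeastLessThan_concat[of 0 n N "\<lambda>l. r ^ ((l - n) + (n - l))"] \<open>n < N\<close>
    by (simp add: lessThan_atLeast0)
  also have "(\<Sum>l<n. r ^ ((l - n) + (n - l))) \<le> (\<Sum>l<n. r ^ (n - Suc l))"
    using r by (intro sum_mono power_decreasing) auto
  also have "\<dots> = (\<Sum>l<n. r ^ l)" by (rule sum.nat_diff_reindex)
  also have "\<dots> \<le> 1 / (1 - r)" using r by (rule sum_geometric_le)
  also have "(\<Sum>l\<in>{n..<N}. r ^ ((l - n) + (n - l))) = (\<Sum>l<N - n. r ^ l)"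
    by (subst sum.atLeastLessThan_shift_0) (simp add: lessThan_atLeast0)
  also have "\<dots> \<le> 1 / (1 - r)" using r by (rule sum_geometric_le)
  finally show ?thesis by simp
qed

text \<open>Expanding the square gives the sum of the covariance matrix, each of whose
  \<open>N\<close> rows is dominated by a two-sided geometric series.\<close>

lemma (in prob_space) average_second_moment_le:
  fixes X :: "nat \<Rightarrow> 'a \<Rightarrow> complex"
  assumes [measurable]: "\<And>n. X n \<in> borel_measurable M"
    and B: "\<And>n \<omega>. cmod (X n \<omega>) \<le> B"
    and cov: "\<And>n l. n \<le> l \<Longrightarrow> cmod (expectation (\<lambda>\<omega>. X n \<omega> * cnj (X l \<omega>))) \<le> C * r ^ (l - n)"
    and r: "0 \<le> r" "r < 1"
  shows "expectation (\<lambda>\<omega>. (cmod (\<Sum>n<N. X n \<omega>))\<^sup>2) \<le> real N * (C * (2 / (1 - r)))"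
proof -
  have int: "integrable M (\<lambda>\<omega>. X n \<omega> * cnj (X l \<omega>))" for n l
    by (rule integrable_const_bound[where B = "B * B"])
      (auto simp: norm_mult intro!: mult_mono B order_trans[OF norm_ge_zero B])
  have sym: "cmod (expectation (\<lambda>\<omega>. X n \<omega> * cnj (X l \<omega>))) =
      cmod (expectation (\<lambda>\<omega>. X l \<omega> * cnj (X n \<omega>)))" for n l
  proof -
    have "(\<lambda>\<omega>. X n \<omega> * cnj (X l \<omega>)) = (\<lambda>\<omega>. cnj (X l \<omega> * cnj (X n \<omega>)))"
      by (auto simp: mult.commute)
    then show ?thesis by (simp only: Bochner_Integration.integral_cnj complex_mod_cnj)
  qed
  have C: "C \<ge> 0" using order_trans[OF norm_ge_zero cov[of 0 0]] by simp
  have cov': "cmod (expectation (\<lambda>\<omega>. X n \<omega> * cnj (X l \<omega>))) \<le> C * r ^ ((l - n) + (n - l))" for n l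
  proof (cases "n \<le> l")
    case True
    then show ?thesis using cov[OF True] by simp
  next
    case False
    then have "l \<le> n" by simp
    then show ?thesis using cov[OF \<open>l \<le> n\<close>] by (subst sym) simp
  qed
  have eq: "complex_of_real ((cmod (\<Sum>n<N. X n \<omega>))\<^sup>2) = (\<Sum>n<N. \<Sum>l<N. X n \<omega> * cnj (X l \<omega>))" for \<omega>
    by (simp only: complex_norm_square cnj_sum sum_product)
  have "complex_of_real (expectation (\<lambda>\<omega>. (cmod (\<Sum>n<N. X n \<omega>))\<^sup>2)) =
      expectation (\<lambda>\<omega>. \<Sum>n<N. \<Sum>l<N. X n \<omega> * cnj (X l \<omega>))"
    by (simp only: eq[symmetric] integral_complex_of_real)
  also have "\<dots> = (\<Sum>n<N. \<Sum>l<N. expectation (\<lambda>\<omega>. X n \<omega> * cnj (X l \<omega>)))"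
    by (subst Bochner_Integration.integral_sum; (subst Bochner_Integration.integral_sum)?)
      (auto intro!: int)
  finally have "cmod (complex_of_real (expectation (\<lambda>\<omega>. (cmod (\<Sum>n<N. X n \<omega>))\<^sup>2))) \<le>
      (\<Sum>n<N. \<Sum>l<N. C * r ^ ((l - n) + (n - l)))"
    by (auto intro!: sum_norm_le cov' order_trans[OF norm_sum] sum_mono)
  also have "\<dots> \<le> (\<Sum>n<N. C * (2 / (1 - r)))"
    unfolding sum_distrib_left[symmetric]
    using C sum_geometric_distance_le[OF r] by (intro sum_mono mult_left_mono) auto
  finally show ?thesis by simp
qed

text \<open>Along squares the expected squared averages are dominated by a multiple of
  \<open>1 / j\<^sup>2\<close>. Their series therefore converges almost surely, and its terms tend
  to 0.\<close>

lemma (in prob_space) strong_law_decaying_correlations: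
  fixes X :: "nat \<Rightarrow> 'a \<Rightarrow> complex"
  assumes [measurable]: "\<And>n. X n \<in> borel_measurable M"
    and B: "\<And>n \<omega>. cmod (X n \<omega>) \<le> B"
    and cov: "\<And>n l. n \<le> l \<Longrightarrow> cmod (expectation (\<lambda>\<omega>. X n \<omega> * cnj (X l \<omega>))) \<le> C * r ^ (l - n)"
    and r: "0 \<le> r" "r < 1"
  shows "AE \<omega> in M. (\<lambda>N. (\<Sum>n<N. X n \<omega>) / of_nat N) \<longlonglongrightarrow> 0"
proof -
  define K where "K = C * (2 / (1 - r))"
  define u where "u j \<omega> = (cmod ((\<Sum>n<(Suc j)\<^sup>2. X n \<omega>) / of_nat ((Suc j)\<^sup>2)))\<^sup>2" for j \<omega>
  have [measurable]: "u j \<in> borel_measurable M" for j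
    unfolding u_def by measurable
  have "cmod ((\<Sum>n<N. X n \<omega>) / of_nat N) \<le> B" for N \<omega>
    using B[of 0 \<omega>] by (intro norm_average_le B) (auto intro: order_trans[OF norm_ge_zero])
  then have ub: "u j \<omega> \<le> B\<^sup>2" for j \<omega>
    unfolding u_def by (intro power_mono norm_ge_zero) blast
  have u0: "0 \<le> u j \<omega>" for j \<omega> by (simp add: u_def)
  have int: "integrable M (u j)" for j
    by (rule integrable_const_bound[where B = "B\<^sup>2"]) (use u0 ub in auto)
  have Eu: "expectation (u j) \<le> K * inverse (real (Suc j) ^ 2)" for j
  proof -
    have "expectation (u j) =
        expectation (\<lambda>\<omega>. (cmod (\<Sum>n<(Suc j)\<^sup>2. X n \<omega>))\<^sup>2) / (real ((Suc j)\<^sup>2))\<^sup>2"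
      unfolding u_def by (simp add: norm_divide power_divide norm_power del: of_nat_Suc)
    also have "\<dots> \<le> (real ((Suc j)\<^sup>2) * K) / (real ((Suc j)\<^sup>2))\<^sup>2"
      unfolding K_def by (intro divide_right_mono average_second_moment_le[OF _ B cov r]) auto
    also have "\<dots> = K * inverse (real (Suc j) ^ 2)"
    proof -
      have "(x\<^sup>2 * K) / (x\<^sup>2)\<^sup>2 = K * inverse (x\<^sup>2)" if "x \<noteq> 0" for x :: real
        using that by (simp add: power2_eq_square field_simps)
      from this[of "real (Suc j)"] show ?thesis by (simp only: of_nat_power of_nat_0_less_iff)
    qed
    finally show ?thesis .
  qed
  have K: "summable (\<lambda>j. K * inverse (real (Suc j) ^ 2))"
    by (intro summable_mult, subst summable_Suc_iff[of "\<lambda>j. inverse (real j ^ 2)"])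
      (rule inverse_power_summable, simp)
  have K0: "0 \<le> K * inverse (real (Suc j) ^ 2)" for j
    by (rule order_trans[OF _ Eu]) (simp add: u0)
  have "(\<integral>\<^sup>+\<omega>. (\<Sum>j. ennreal (u j \<omega>)) \<partial>M) = (\<Sum>j. \<integral>\<^sup>+\<omega>. ennreal (u j \<omega>) \<partial>M)"
    by (rule nn_integral_suminf) measurable
  also have "\<dots> = (\<Sum>j. ennreal (expectation (u j)))"
    using int u0 by (simp add: nn_integral_eq_integral)
  also have "\<dots> \<le> (\<Sum>j. ennreal (K * inverse (real (Suc j) ^ 2)))"
    by (intro suminf_le ennreal_leI Eu summableI)
  also have "\<dots> < \<infinity>"
    by (simp only: suminf_ennreal2[OF K0 K] ennreal_less_top infinity_ennreal_def)
  finally have "AE \<omega> in M. (\<Sum>j. ennreal (u j \<omega>)) \<noteq> \<infinity>"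
    by (intro nn_integral_PInf_AE) auto
  then show ?thesis
  proof eventually_elim
    case (elim \<omega>)
    then have "summable (\<lambda>j. u j \<omega>)"
      using u0 by (intro summable_suminf_not_top) auto
    then have "(\<lambda>j. sqrt (u j \<omega>)) \<longlonglongrightarrow> sqrt 0"
      by (intro tendsto_real_sqrt summable_LIMSEQ_zero)
    then have "(\<lambda>j. cmod ((\<Sum>n<(Suc j)\<^sup>2. X n \<omega>) / of_nat ((Suc j)\<^sup>2))) \<longlonglongrightarrow> 0"
      unfolding u_def by simp
    then show ?case
      by (intro average_tendsto_0_if_squares[OF B]) (rule tendsto_norm_zero_cancel)
  qed
qed

section \<open>Almost orthogonal functions of independent letters\<close>

context sequence_space
begin

text \<open>Independence of the first \<open>n\<close> letters from the rest, as Fubini: the tail is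
  resampled from an independent word, and the inner integral is the conditional mean given those
  letters.\<close>

lemma integral_comb_seq:
  fixes f :: "(nat \<Rightarrow> 'a) \<Rightarrow> 'b::{banach, second_countable_topology}"
  assumes [measurable]: "f \<in> borel_measurable S" and "\<And>\<omega>. norm (f \<omega>) \<le> B"
  shows "(\<integral>\<omega>. f \<omega> \<partial>S) = (\<integral>\<omega>. \<integral>\<omega>'. f (comb_seq n \<omega> \<omega>') \<partial>S \<partial>S)"
proof -
  interpret SS: pair_prob_space S S ..
  have "(\<integral>\<omega>. f \<omega> \<partial>S) = (\<integral>\<omega>. f \<omega> \<partial>(distr (S \<Otimes>\<^sub>M S) S (\<lambda>(\<omega>, \<omega>'). comb_seq n \<omega> \<omega>')))"
    by (simp only: PiM_comb_seq)
  also have "\<dots> = (\<integral>x. f ((\<lambda>(\<omega>, \<omega>'). comb_seq n \<omega> \<omega>') x) \<partial>(S \<Otimes>\<^sub>M S))"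
    by (rule integral_distr) measurable
  also have "\<dots> = (\<integral>(\<omega>, \<omega>'). f (comb_seq n \<omega> \<omega>') \<partial>(S \<Otimes>\<^sub>M S))"
    by (simp only: case_prod_beta')
  also have "\<dots> = (\<integral>\<omega>. \<integral>\<omega>'. f (comb_seq n \<omega> \<omega>') \<partial>S \<partial>S)"
    by (rule SS.integral_fst[symmetric], rule SS.P.integrable_const_bound[where B = B])
      (use assms in auto)
  finally show ?thesis .
qed

text \<open>\<open>X n\<close> is centred given \<open>n + d\<close> letters but may depend on all
  of them. For \<open>n < l\<close> its proxy \<open>V n l\<close> sees only \<open>l + d\<close>
  letters and so is orthogonal to \<open>X l\<close>; the correlation of \<open>X n\<close> and
  \<open>X l\<close> is thus that of the small error \<open>X n - V n l\<close>.\<close>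

lemma strong_law_martingale_differences:
  fixes X :: "nat \<Rightarrow> (nat \<Rightarrow> 'a) \<Rightarrow> complex"
  assumes X[measurable]: "\<And>n. X n \<in> borel_measurable S"
    and B: "\<And>n \<omega>. cmod (X n \<omega>) \<le> B"
    and mean: "\<And>n \<omega>. (\<integral>\<omega>'. X n (comb_seq (n + d) \<omega> \<omega>') \<partial>S) = 0"
    and V[measurable]: "\<And>n l. V n l \<in> borel_measurable S"
    and adapted: "\<And>n l \<omega> \<omega>'. n < l \<Longrightarrow> V n l (comb_seq (l + d) \<omega> \<omega>') = V n l \<omega>"
    and approx: "\<And>n l \<omega>. n < l \<Longrightarrow> cmod (X n \<omega> - V n l \<omega>) \<le> C * r ^ (l - n)"
    and r: "0 \<le> r" "r < 1"
  shows "AE \<omega> in S. (\<lambda>N. (\<Sum>n<N. X n \<omega>) / of_nat N) \<longlonglongrightarrow> 0"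
proof -
  have B0: "0 \<le> B" using B norm_ge_zero order_trans by blast
  have C0: "0 \<le> C * r" using order_trans[OF norm_ge_zero approx[of 0 1]] by simp
  have rpow: "C * r ^ (l - n) \<le> C * r" if "n < l" for n l
  proof -
    have e: "l - n = Suc (l - n - 1)" using that by simp
    have "C * r * r ^ (l - n - 1) \<le> C * r * 1"
      using r C0 by (intro mult_left_mono power_le_one) auto
    then show ?thesis by (subst e) (simp add: mult_ac)
  qed
  \<comment> \<open>\<open>B * B\<close> pays for the diagonal, \<open>\<bar>C\<bar> * B\<close> for
    the rest. The absolute value is taken since the sign of \<open>C\<close> is not controlled when
    \<open>r = 0\<close>.\<close>
  have cov: "cmod (\<integral>\<omega>. X n \<omega> * cnj (X l \<omega>) \<partial>S) \<le> (\<bar>C\<bar> * B + B * B) * r ^ (l - n)" if "n \<le> l" for n l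
  proof (cases "n = l")
    case True
    have "cmod (\<integral>\<omega>. X n \<omega> * cnj (X l \<omega>) \<partial>S) \<le> B * B"
      by (rule P.norm_expectation_le) (use B B0 in \<open>auto simp: norm_mult intro!: mult_mono\<close>)
    then show ?thesis using True B0 by (simp add: add_increasing)
  next
    case False
    with that have "n < l" by simp
    have VB: "cmod (V n l \<omega>) \<le> B + C * r" for \<omega>
      using norm_triangle_ineq2[of "V n l \<omega>" "X n \<omega>"] B[of n \<omega>] approx[OF \<open>n < l\<close>, of \<omega>] rpow[OF \<open>n < l\<close>]
      by (simp add: norm_minus_commute)
    have VX: "cmod (V n l \<omega> * cnj (X l \<omega>)) \<le> (B + C * r) * B" for \<omega>
      using VB B B0 C0 by (auto simp: norm_mult intro!: mult_mono)
    have "(\<integral>\<omega>. V n l \<omega> * cnj (X l \<omega>) \<partial>S) =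
        (\<integral>\<omega>. \<integral>\<omega>'. V n l (comb_seq (l + d) \<omega> \<omega>') * cnj (X l (comb_seq (l + d) \<omega> \<omega>')) \<partial>S \<partial>S)"
      by (rule integral_comb_seq[OF _ VX]) measurable
    also have "\<dots> = 0" using mean[of l] by (simp add: adapted[OF \<open>n < l\<close>])
    finally have "(\<integral>\<omega>. X n \<omega> * cnj (X l \<omega>) \<partial>S) = (\<integral>\<omega>. X n \<omega> * cnj (X l \<omega>) \<partial>S) - (\<integral>\<omega>. V n l \<omega> * cnj (X l \<omega>) \<partial>S)"
      by simp
    also have "\<dots> = (\<integral>\<omega>. (X n \<omega> - V n l \<omega>) * cnj (X l \<omega>) \<partial>S)"
    proof (subst Bochner_Integration.integral_diff[symmetric])
      show "integrable S (\<lambda>\<omega>. X n \<omega> * cnj (X l \<omega>))"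
        by (rule P.integrable_const_bound[where B = "B * B"])
          (use B B0 in \<open>auto simp: norm_mult intro!: mult_mono\<close>)
      show "integrable S (\<lambda>\<omega>. V n l \<omega> * cnj (X l \<omega>))"
        by (rule P.integrable_const_bound) (use VX in auto)
    qed (simp add: left_diff_distrib)
    also have "cmod \<dots> \<le> \<bar>C\<bar> * r ^ (l - n) * B"
    proof (rule P.norm_expectation_le)
      fix \<omega>
      have "C * r ^ (l - n) \<le> \<bar>C\<bar> * r ^ (l - n)" using r by (intro mult_right_mono) auto
      then show "cmod ((X n \<omega> - V n l \<omega>) * cnj (X l \<omega>)) \<le> \<bar>C\<bar> * r ^ (l - n) * B"
        using approx[OF \<open>n < l\<close>, of \<omega>] B[of l \<omega>] B0 r by (auto simp: norm_mult intro!: mult_mono)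
    qed
    also have "\<dots> \<le> (\<bar>C\<bar> * B + B * B) * r ^ (l - n)"
      using B0 r by (simp add: algebra_simps)
    finally show ?thesis .
  qed
  show ?thesis
    by (rule P.strong_law_decaying_correlations[OF X B cov r])
qed

end

section \<open>Fourier transforms of atomless measures\<close>

text \<open>Logarithmic mean of the cosine over the scales between \<open>a / s\<close> and
  \<open>a\<close>; \<open>\<theta>\<close> stands for the fractional part of the walk.\<close>

definition cos_mean :: "real \<Rightarrow> real \<Rightarrow> real" where
  "cos_mean s a = integral {0..1} (\<lambda>\<theta>. cos (a * s powr (-\<theta>)))"

lemma cos_mean_le_1: "\<bar>cos_mean s a\<bar> \<le> 1"
proof (cases "(\<lambda>\<theta>. cos (a * s powr (-\<theta>))) integrable_on {0..1}")
  case True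
  then have "norm (cos_mean s a) \<le> integral {0..1::real} (\<lambda>_. 1)"
    unfolding cos_mean_def by (intro Henstock_Kurzweil_Integration.integral_norm_bound_integral) auto
  then show ?thesis by simp
qed (simp add: cos_mean_def not_integrable_integral)

lemma continuous_cos_mean:
  assumes "s > 1"
  shows "continuous_on UNIV (cos_mean s)"
proof -
  have "continuous_on UNIV (\<lambda>a. integral (cbox 0 1) (\<lambda>\<theta>. cos (a * s powr (-\<theta>))))"
    using assms by (intro integral_continuous_on_param) (auto intro!: continuous_intros simp: split_beta)
  then show ?thesis by (simp add: cos_mean_def[abs_def])
qed

text \<open>Integration by parts: the phase \<open>a * s powr (-\<theta>)\<close> has derivative of
  size at least \<open>\<bar>a\<bar> * ln s / s\<close>, so the oscillation cancels.\<close>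

lemma cos_mean_decay:
  assumes "s > 1" "a \<noteq> 0"
  shows "\<bar>cos_mean s a\<bar> \<le> (2 * s / ln s + s) / \<bar>a\<bar>"
proof -
  have s: "ln s > 0" using assms by simp
  \<comment> \<open>\<open>F\<close> is the boundary term and \<open>R\<close> the remaining
    integrand. Since \<open>s powr \<theta> \<le> s\<close>, the two ends of \<open>F\<close> yield
    \<open>2 * s / ln s\<close> and \<open>R\<close> yields \<open>s\<close>, both over
    \<open>\<bar>a\<bar>\<close>.\<close>
  define F where "F \<theta> = - (s powr \<theta>) * sin (a * s powr (-\<theta>)) / (a * ln s)" for \<theta>
  define R where "R \<theta> = s powr \<theta> * sin (a * s powr (-\<theta>)) / a" for \<theta>
  have deriv: "(F has_real_derivative cos (a * s powr (-\<theta>)) - R \<theta>) (at \<theta> within {0..1})" for \<theta>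
  proof -
    define P Q where "P \<theta> = s powr \<theta>" and "Q \<theta> = s powr (-\<theta>)" for \<theta>
    have dP: "(P has_real_derivative P \<theta> * ln s) (at \<theta> within {0..1})"
      and dQ: "(Q has_real_derivative - Q \<theta> * ln s) (at \<theta> within {0..1})"
      unfolding P_def Q_def powr_def using assms by (auto intro!: derivative_eq_intros)
    have "P \<theta> * Q \<theta> = 1" unfolding P_def Q_def using assms by (simp add: powr_minus)
    then have PQ: "P \<theta> * (Q \<theta> * x) = x" for x by (simp flip: mult.assoc)
    have "((\<lambda>\<theta>. - P \<theta> * sin (a * Q \<theta>)) has_real_derivative
        - (P \<theta> * ln s * sin (a * Q \<theta>) - a * ln s * (P \<theta> * (Q \<theta> * cos (a * Q \<theta>)))))
        (at \<theta> within {0..1})"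
      by (rule derivative_eq_intros dP dQ refl)+ (simp add: algebra_simps)
    note DERIV_cdivide[OF this, of "a * ln s"]
    also have "- (P \<theta> * ln s * sin (a * Q \<theta>) - a * ln s * (P \<theta> * (Q \<theta> * cos (a * Q \<theta>)))) / (a * ln s)
        = cos (a * Q \<theta>) - P \<theta> * sin (a * Q \<theta>) / a"
      unfolding PQ using assms s by (simp add: field_simps)
    finally show ?thesis unfolding F_def[abs_def] R_def P_def Q_def .
  qed
  have "((\<lambda>\<theta>. cos (a * s powr (-\<theta>)) - R \<theta>) has_integral F 1 - F 0) {0..1}"
    by (rule fundamental_theorem_of_calculus)
      (use deriv in \<open>auto simp: has_real_derivative_iff_has_vector_derivative\<close>)
  moreover have contR: "continuous_on {0..1} R"
    unfolding R_def using assms by (intro continuous_intros) auto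
  then have "(R has_integral integral {0..1} R) {0..1}"
    by (simp add: integrable_continuous_real integrable_integral)
  ultimately have "((\<lambda>\<theta>. cos (a * s powr (-\<theta>)) - R \<theta> + R \<theta>) has_integral F 1 - F 0 + integral {0..1} R) {0..1}"
    by (rule has_integral_add)
  then have eq: "cos_mean s a = F 1 - F 0 + integral {0..1} R"
    unfolding cos_mean_def by (simp add: integral_unique)
  have F: "\<bar>F \<theta>\<bar> \<le> s / (\<bar>a\<bar> * ln s)" if "\<theta> \<in> {0..1}" for \<theta>
  proof -
    have "s powr \<theta> \<le> s powr 1" using that assms by (intro powr_mono) auto
    then have "s powr \<theta> * \<bar>sin (a * s powr (-\<theta>))\<bar> \<le> s * 1"
      using assms by (intro mult_mono) auto
    then show ?thesis using assms s by (simp add: F_def abs_mult divide_right_mono)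
  qed
  have R: "\<bar>R \<theta>\<bar> \<le> s / \<bar>a\<bar>" if "\<theta> \<in> {0..1}" for \<theta>
  proof -
    have "s powr \<theta> \<le> s powr 1" using that assms by (intro powr_mono) auto
    then have "s powr \<theta> * \<bar>sin (a * s powr (-\<theta>))\<bar> \<le> s * 1"
      using assms by (intro mult_mono) auto
    then show ?thesis by (simp add: R_def abs_mult divide_right_mono)
  qed
  have "norm (integral {0..1} R) \<le> integral {0..1::real} (\<lambda>_. s / \<bar>a\<bar>)"
    using contR R by (intro Henstock_Kurzweil_Integration.integral_norm_bound_integral) (auto intro!: integrable_continuous_real)
  then have "\<bar>integral {0..1} R\<bar> \<le> s / \<bar>a\<bar>" by simp
  with F[of 0] F[of 1] have "\<bar>cos_mean s a\<bar> \<le> s / (\<bar>a\<bar> * ln s) + s / (\<bar>a\<bar> * ln s) + s / \<bar>a\<bar>"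
    unfolding eq by simp
  also have "\<dots> = (2 * s / ln s + s) / \<bar>a\<bar>"
    using assms s by (simp add: field_simps)
  finally show ?thesis .
qed

section \<open>Wiener's argument along an equidistributed sequence of scales\<close>

context real_distribution
begin

text \<open>The squared modulus is the characteristic function of the difference of two independent
  copies, hence real. It is linear in the cosine, so averages over scales can be taken inside the
  double integral.\<close>

lemma cmod_char_square:
  "(cmod (char M \<xi>))\<^sup>2 = (\<integral>y. \<integral>z. cos (\<xi> * (y - z)) \<partial>M \<partial>M)"
proof -
  have c: "integrable M (\<lambda>x. cos (\<xi> * x))" and s: "integrable M (\<lambda>x. sin (\<xi> * x))"
    by (rule integrable_const_bound[where B = 1]; simp)+
  have eq: "iexp (\<xi> * x) = Complex (cos (\<xi> * x)) (sin (\<xi> * x))" for x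
    unfolding cis_conv_exp[symmetric] by (simp add: complex_eq_iff)
  have int: "integrable M (\<lambda>x. iexp (\<xi> * x))"
    by (rule integrable_iexp) auto
  have "Re (char M \<xi>) = (\<integral>x. cos (\<xi> * x) \<partial>M)" "Im (char M \<xi>) = (\<integral>x. sin (\<xi> * x) \<partial>M)"
    using integral_Re[OF int] integral_Im[OF int]
    by (simp_all only: char_def eq complex.sel)
  moreover have "(\<integral>y. \<integral>z. cos (\<xi> * (y - z)) \<partial>M \<partial>M) =
      (\<integral>y. cos (\<xi> * y) * (\<integral>x. cos (\<xi> * x) \<partial>M) + sin (\<xi> * y) * (\<integral>x. sin (\<xi> * x) \<partial>M) \<partial>M)"
    using c s by (simp add: right_diff_distrib cos_diff)
  ultimately show ?thesis
    unfolding cmod_power2 using c s by (simp add: power2_eq_square)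
qed

text \<open>Averaging the cosine over scales gives \<open>cos_mean\<close> as \<open>N\<close>
  grows; off the diagonal this decays as \<open>D\<close> grows. Both limits pass the double
  integral by dominated convergence. \<open>L\<close> is chosen before \<open>x\<close>, so it
  serves all walks at once.\<close>

lemma wiener_along_equidistributed:
  assumes atomless: "\<And>z. measure M {z} = 0" and "s > 1" "\<kappa> \<noteq> 0"
  obtains L :: "nat \<Rightarrow> real" where "L \<longlonglongrightarrow> 0"
    and "\<And>x D. equidistributed_mod_1 x \<Longrightarrow>
      (\<lambda>N. (\<Sum>k<N. (cmod (char M (\<kappa> * s powr (real D - frac (x k)))))\<^sup>2) / real N) \<longlonglongrightarrow> L D"
proof
  define L where "L D = (\<integral>y. \<integral>z. cos_mean s (\<kappa> * s powr real D * (y - z)) \<partial>M \<partial>M)" for D :: nat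
  have [measurable]: "cos_mean s \<in> borel_measurable borel"
    using continuous_cos_mean[OF \<open>s > 1\<close>] by (rule borel_measurable_continuous_onI)
  have bound1: "\<bar>\<integral>z. f z \<partial>M\<bar> \<le> 1" if "\<And>z. \<bar>f z\<bar> \<le> 1" for f :: "real \<Rightarrow> real"
    using norm_expectation_le[of f 1] that by simp
  have "(\<lambda>D. \<integral>z. cos_mean s (\<kappa> * s powr real D * (y - z)) \<partial>M) \<longlonglongrightarrow> (\<integral>z. 0 \<partial>M)" for y
  proof (rule integral_dominated_convergence[where w = "\<lambda>_. 1"])
    \<comment> \<open>The diagonal, where nothing decays, is null because there are no
      atoms.\<close>
    have "AE z in M. z \<noteq> y"
      using atomless[of y] by (intro AE_I[of _ _ "{y}"]) (auto simp: emeasure_eq_measure)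
    then show "AE z in M. (\<lambda>D. cos_mean s (\<kappa> * s powr real D * (y - z))) \<longlonglongrightarrow> 0"
    proof eventually_elim
      case (elim z)
      let ?C = "2 * s / ln s + s" and ?d = "\<bar>\<kappa>\<bar> * \<bar>y - z\<bar>"
      have d: "?d > 0" using elim assms by simp
      have "(\<lambda>D. inverse s ^ D) \<longlonglongrightarrow> 0"
        using \<open>s > 1\<close> by (intro LIMSEQ_realpow_zero) (auto simp: inverse_le_1_iff field_simps)
      then have lim: "(\<lambda>D. ?C / ?d * inverse s ^ D) \<longlonglongrightarrow> 0"
        by (rule tendsto_mult_right_zero)
      show ?case
      proof (rule Lim_null_comparison[OF _ lim], rule always_eventually, rule allI)
        fix D :: nat
        have "\<bar>cos_mean s (\<kappa> * s powr real D * (y - z))\<bar> \<le> ?C / \<bar>\<kappa> * s powr real D * (y - z)\<bar>"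
          using assms elim by (intro cos_mean_decay) auto
        also have "\<dots> = ?C / ?d * inverse s ^ D"
          using assms by (simp add: abs_mult powr_realpow power_inverse divide_inverse mult_ac)
        finally show "norm (cos_mean s (\<kappa> * s powr real D * (y - z))) \<le> ?C / ?d * inverse s ^ D"
          by simp
      qed
    qed
  qed (auto simp: cos_mean_le_1)
  then have inner: "(\<lambda>D. \<integral>z. cos_mean s (\<kappa> * s powr real D * (y - z)) \<partial>M) \<longlonglongrightarrow> 0" for y
    by simp
  have "L \<longlonglongrightarrow> (\<integral>y. 0 \<partial>M)"
    unfolding L_def
    by (rule integral_dominated_convergence[where w = "\<lambda>_. 1"])
      (auto simp: inner intro!: bound1 cos_mean_le_1)
  then show "L \<longlonglongrightarrow> 0" by simp
  fix x :: "nat \<Rightarrow> real" and D :: nat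
  assume x: "equidistributed_mod_1 x"
  define g where "g N a = (\<Sum>k<N. cos (a * s powr (- frac (x k)))) / real N" for N :: nat and a
  have [measurable]: "g N \<in> borel_measurable borel" for N unfolding g_def by measurable
  have g1: "\<bar>g N a\<bar> \<le> 1" for N a
    unfolding g_def using norm_average_le[of "\<lambda>k. cos (a * s powr (- frac (x k)))" 1 N] by simp
  have glim: "(\<lambda>N. g N a) \<longlonglongrightarrow> cos_mean s a" for a
    unfolding g_def cos_mean_def using \<open>s > 1\<close>
    by (intro equidistributed_average[OF x]) (auto intro!: continuous_intros)
  have inner: "(\<lambda>N. \<integral>z. g N (\<kappa> * s powr real D * (y - z)) \<partial>M) \<longlonglongrightarrow>
      (\<integral>z. cos_mean s (\<kappa> * s powr real D * (y - z)) \<partial>M)" for y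
    by (rule integral_dominated_convergence[where w = "\<lambda>_. 1"]) (auto simp: g1 glim)
  have "(\<lambda>N. \<integral>y. \<integral>z. g N (\<kappa> * s powr real D * (y - z)) \<partial>M \<partial>M) \<longlonglongrightarrow> L D"
    unfolding L_def
    by (rule integral_dominated_convergence[where w = "\<lambda>_. 1"])
      (auto simp: inner intro!: bound1 g1)
  moreover have "(\<integral>y. \<integral>z. g N (\<kappa> * s powr real D * (y - z)) \<partial>M \<partial>M) =
      (\<Sum>k<N. (cmod (char M (\<kappa> * s powr (real D - frac (x k)))))\<^sup>2) / real N" for N
  proof -
    have int: "integrable M (\<lambda>z. cos (a * (y - z)))" for a y
      by (rule integrable_const_bound[where B = 1]) auto
    have int2: "integrable M (\<lambda>y. \<integral>z. cos (a * (y - z)) \<partial>M)" for a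
      by (rule integrable_const_bound[where B = 1]) (auto intro!: bound1)
    have e: "\<kappa> * s powr real D * (y - z) * s powr (- frac (x k)) =
        (\<kappa> * s powr (real D - frac (x k))) * (y - z)" for y z k
      using \<open>s > 1\<close> by (simp add: powr_diff powr_minus divide_inverse)
    have "(\<integral>y. \<integral>z. g N (\<kappa> * s powr real D * (y - z)) \<partial>M \<partial>M) =
        (\<Sum>k<N. \<integral>y. \<integral>z. cos ((\<kappa> * s powr (real D - frac (x k))) * (y - z)) \<partial>M \<partial>M) / real N"
      unfolding g_def e by (simp add: int int2 Bochner_Integration.integral_sum)
    then show ?thesis by (simp only: cmod_char_square)
  qed
  ultimately show "(\<lambda>N. (\<Sum>k<N. (cmod (char M (\<kappa> * s powr (real D - frac (x k)))))\<^sup>2) / real N) \<longlonglongrightarrow> L D"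
    by simp
qed

end

text \<open>The difference of the two transforms at \<open>\<xi>\<close> is an average of unimodular
  multiples of its values at \<open>\<rho> i * \<xi>\<close>. Iteration drives the frequencies to 0,
  where the difference is continuous and vanishes.\<close>

lemma char_eqI_self_similar:
  fixes p :: "'i pmf" and \<rho> t :: "'i \<Rightarrow> real"
  assumes M: "real_distribution M" "real_distribution N"
    and \<rho>: "\<And>i. \<bar>\<rho> i\<bar> \<le> r" and r: "0 < r" "r < 1"
    and charM: "\<And>\<xi>. char M \<xi> = (\<integral>i. iexp (\<xi> * t i) * char M (\<rho> i * \<xi>) \<partial>measure_pmf p)"
    and charN: "\<And>\<xi>. char N \<xi> = (\<integral>i. iexp (\<xi> * t i) * char N (\<rho> i * \<xi>) \<partial>measure_pmf p)"
  shows "M = N"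
proof (rule Levy_uniqueness[OF M])
  interpret M: real_distribution M by fact
  interpret N: real_distribution N by fact
  define \<delta> where "\<delta> \<xi> = char M \<xi> - char N \<xi>" for \<xi>
  have step: "\<delta> \<xi> = (\<integral>i. iexp (\<xi> * t i) * \<delta> (\<rho> i * \<xi>) \<partial>measure_pmf p)" for \<xi>
  proof -
    have "integrable (measure_pmf p) (\<lambda>i. iexp (\<xi> * t i) * char M (\<rho> i * \<xi>))"
      "integrable (measure_pmf p) (\<lambda>i. iexp (\<xi> * t i) * char N (\<rho> i * \<xi>))"
      by (rule measure_pmf.integrable_const_bound[where B = 1];
        simp add: norm_mult M.cmod_char_le_1 N.cmod_char_le_1)+
    then show ?thesis
      unfolding \<delta>_def charM[of \<xi>] charN[of \<xi>] by (simp add: right_diff_distrib)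
  qed
  have "cmod (\<delta> \<xi>) \<le> e" if "e > 0" for \<xi> e
  proof -
    have "isCont \<delta> 0"
      unfolding \<delta>_def by (intro continuous_intros M.isCont_char N.isCont_char)
    moreover have "\<delta> 0 = 0" by (simp add: \<delta>_def M.char_zero N.char_zero)
    ultimately obtain d where d: "d > 0" "\<And>\<xi>. \<bar>\<xi>\<bar> < d \<Longrightarrow> cmod (\<delta> \<xi>) < e"
      using \<open>e > 0\<close> by (auto simp: continuous_at_eps_delta dist_norm)
    have scale: "cmod (\<delta> \<xi>) \<le> e" if "\<bar>\<xi>\<bar> * r ^ n < d" for n \<xi>
      using that
    proof (induction n arbitrary: \<xi>)
      case 0
      then show ?case using d(2)[of \<xi>] by simp
    next
      case (Suc n)
      have "cmod (\<delta> (\<rho> i * \<xi>)) \<le> e" for i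
      proof (rule Suc.IH)
        have "\<bar>\<rho> i\<bar> * (\<bar>\<xi>\<bar> * r ^ n) \<le> r * (\<bar>\<xi>\<bar> * r ^ n)"
          using \<rho> r by (intro mult_right_mono) auto
        then show "\<bar>\<rho> i * \<xi>\<bar> * r ^ n < d"
          using Suc.prems by (simp add: abs_mult mult_ac)
      qed
      then show ?case
        by (subst step) (auto intro!: measure_pmf.norm_expectation_le simp: norm_mult)
    qed
    have "(\<lambda>n. \<bar>\<xi>\<bar> * r ^ n) \<longlonglongrightarrow> 0"
      using r by (intro tendsto_mult_right_zero LIMSEQ_realpow_zero) auto
    then have "\<forall>\<^sub>F n in sequentially. \<bar>\<xi>\<bar> * r ^ n < d"
      by (rule order_tendstoD) (rule d)
    then show ?thesis using scale by (auto simp: eventually_sequentially)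
  qed
  then have "cmod (\<delta> \<xi>) \<le> 0" for \<xi> by (rule field_le_epsilon) simp
  then show "char M = char N" by (auto simp: \<delta>_def)
qed

section \<open>Coding by Bernoulli sequences\<close>

lemma cmod_iexp_diff_le: "cmod (iexp x - iexp y) \<le> \<bar>x - y\<bar>"
proof -
  have "iexp x - iexp y = iexp y * (iexp (x - y) - 1)"
    by (simp add: right_diff_distrib flip: exp_add)
  then have "cmod (iexp x - iexp y) = cmod (iexp (x - y) - 1)"
    by (simp add: norm_mult)
  then show ?thesis using iexp_approx1[of "x - y" 0] by simp
qed

text \<open>Letter \<open>i\<close> stands for the similarity of ratio
  \<open>s powr (- \<alpha> i)\<close> and translation \<open>t i\<close>. The natural number
  \<open>J\<close> bounds one step of the walk and hence the length of a block.\<close>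

locale bernoulli_coding =
  fixes p :: "'i pmf" and \<alpha> t :: "'i \<Rightarrow> real" and s a \<tau> :: real and J :: nat
  assumes s: "1 < s" and a: "0 < a" and \<alpha>_lower: "\<And>i. a \<le> \<alpha> i" and \<alpha>_upper: "\<And>i. \<alpha> i \<le> real J"
    and t_bound: "\<And>i. \<bar>t i\<bar> \<le> \<tau>"
begin

sublocale sequence_space "measure_pmf p"
  by unfold_locales

abbreviation "r \<equiv> s powr (- a)"

lemma r: "0 < r" "r < 1"
  using s a by (auto simp: powr_less_one)

definition walk :: "nat \<Rightarrow> (nat \<Rightarrow> 'i) \<Rightarrow> real" where
  "walk n \<omega> = (\<Sum>j<n. \<alpha> (\<omega> j))"

text \<open>Image of 0 under the composition of the first \<open>n\<close> maps, the first letter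
  being outermost; \<open>code\<close> is its limit.\<close>

definition partial_code :: "nat \<Rightarrow> (nat \<Rightarrow> 'i) \<Rightarrow> real" where
  "partial_code n \<omega> = (\<Sum>j<n. s powr (- walk j \<omega>) * t (\<omega> j))"

definition code :: "(nat \<Rightarrow> 'i) \<Rightarrow> real" where
  "code \<omega> = (\<Sum>j. s powr (- walk j \<omega>) * t (\<omega> j))"

definition code_distr :: "real measure" where
  "code_distr = distr S borel code"

lemma measurable_letter [measurable]: "(\<lambda>\<omega>. f (\<omega> j)) \<in> S \<rightarrow>\<^sub>M borel" for f :: "'i \<Rightarrow> 'b::topological_space"
  by (rule measurable_compose[OF measurable_component_singleton[of j UNIV "\<lambda>_. measure_pmf p"]]) auto

lemma measurable_walk [measurable]: "walk n \<in> borel_measurable S"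
  unfolding walk_def by measurable

lemma measurable_partial_code [measurable]: "partial_code n \<in> borel_measurable S"
  unfolding partial_code_def by measurable

lemma measurable_code [measurable]: "code \<in> borel_measurable S"
  unfolding code_def by measurable

lemma walk_mono: "m \<le> n \<Longrightarrow> walk m \<omega> + a * real (n - m) \<le> walk n \<omega>"
proof (induction n)
  case (Suc n)
  then show ?case
    using \<alpha>_lower[of "\<omega> n"] by (cases "m = Suc n") (auto simp: walk_def Suc_diff_le distrib_left)
qed simp

lemma walk_ge: "a * real n \<le> walk n \<omega>"
  using walk_mono[of 0 n \<omega>] by (simp add: walk_def)

lemma walk_Suc_le: "walk (Suc n) \<omega> \<le> walk n \<omega> + real J"
  using \<alpha>_upper[of "\<omega> n"] by (simp add: walk_def)

lemma scale_le: "s powr (- walk n \<omega>) \<le> r ^ n"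
proof -
  have "s powr (- walk n \<omega>) \<le> s powr (- a * real n)"
    using walk_ge[of n \<omega>] s by (intro powr_mono) auto
  also have "\<dots> = r ^ n" using r(1) by (simp add: powr_realpow[symmetric] powr_powr)
  finally show ?thesis .
qed

lemma code_term_le: "\<bar>s powr (- walk j \<omega>) * t (\<omega> j)\<bar> \<le> r ^ j * \<tau>"
  using scale_le[of j \<omega>] t_bound[of "\<omega> j"] by (auto simp: abs_mult intro!: mult_mono)

lemma summable_code_bound: "summable (\<lambda>j. r ^ j * \<tau>)"
  using r by (intro summable_mult2 summable_geometric) auto

lemma summable_code: "summable (\<lambda>j. s powr (- walk j \<omega>) * t (\<omega> j))"
  by (rule summable_comparison_test'[OF summable_code_bound]) (use code_term_le in auto)

lemma code_bounded: "\<bar>code \<omega>\<bar> \<le> \<tau> / (1 - r)"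
proof -
  have abs: "summable (\<lambda>j. norm (s powr (- walk j \<omega>) * t (\<omega> j)))"
    by (rule summable_comparison_test'[OF summable_code_bound]) (use code_term_le in auto)
  have "norm (code \<omega>) \<le> (\<Sum>j. norm (s powr (- walk j \<omega>) * t (\<omega> j)))"
    unfolding code_def by (rule summable_norm[OF abs])
  also have "\<dots> \<le> (\<Sum>j. r ^ j * \<tau>)"
    by (rule suminf_le[OF _ abs summable_code_bound]) (use code_term_le in auto)
  also have "\<dots> = \<tau> / (1 - r)"
    using r by (subst suminf_mult2[symmetric]) (auto simp: suminf_geometric summable_geometric)
  finally show ?thesis by simp
qed

lemma walk_comb_seq: "j \<le> n \<Longrightarrow> walk j (comb_seq n \<omega> \<omega>') = walk j \<omega>"
  unfolding walk_def by (intro sum.cong) (auto simp: comb_seq_def)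

lemma walk_comb_seq_add: "walk (n + k) (comb_seq n \<omega> \<omega>') = walk n \<omega> + walk k \<omega>'"
proof (induction k)
  case 0
  then show ?case by (simp add: walk_comb_seq) (simp add: walk_def)
next
  case (Suc k)
  then show ?case using comb_seq_add[of n \<omega> \<omega>' k] by (simp add: walk_def add.commute)
qed

lemma partial_code_comb_seq: "j \<le> n \<Longrightarrow> partial_code j (comb_seq n \<omega> \<omega>') = partial_code j \<omega>"
  unfolding partial_code_def by (intro sum.cong) (auto simp: comb_seq_def[of n \<omega> \<omega>'] walk_comb_seq)

text \<open>Renormalisation: the maps of the first \<open>n\<close> letters compose to one affine
  map, which is applied to the point coded by the tail.\<close>

lemma code_comb_seq: "code (comb_seq n \<omega> \<omega>') = partial_code n \<omega> + s powr (- walk n \<omega>) * code \<omega>'"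
proof -
  let ?w = "comb_seq n \<omega> \<omega>'"
  have "code ?w = (\<Sum>j. s powr (- walk (j + n) ?w) * t (?w (j + n))) + partial_code n ?w"
    unfolding code_def partial_code_def by (rule suminf_split_initial_segment[OF summable_code])
  also have "(\<lambda>j. s powr (- walk (j + n) ?w) * t (?w (j + n))) =
      (\<lambda>j. s powr (- walk n \<omega>) * (s powr (- walk j \<omega>') * t (\<omega>' j)))"
    by (rule ext) (simp add: add.commute[of _ n] walk_comb_seq_add comb_seq_add[of n \<omega> \<omega>', unfolded add.commute[of _ n]] powr_diff powr_minus divide_inverse powr_add)
  also have "(\<Sum>j. s powr (- walk n \<omega>) * (s powr (- walk j \<omega>') * t (\<omega>' j))) = s powr (- walk n \<omega>) * code \<omega>'"
    unfolding code_def by (rule suminf_mult[OF summable_code])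
  finally show ?thesis by (simp add: partial_code_comb_seq)
qed

lemma code_partial_code: "\<bar>code \<omega> - partial_code n \<omega>\<bar> \<le> s powr (- walk n \<omega>) * (\<tau> / (1 - r))"
proof -
  \<comment> \<open>The word is cut into its own prefix and tail, so the error is a scaled copy of a
    bounded code.\<close>
  have "comb_seq n \<omega> (\<lambda>j. \<omega> (j + n)) = \<omega>" by (auto simp: comb_seq_def)
  then have "code \<omega> - partial_code n \<omega> = s powr (- walk n \<omega>) * code (\<lambda>j. \<omega> (j + n))"
    using code_comb_seq[of n \<omega> "\<lambda>j. \<omega> (j + n)"] by simp
  then show ?thesis by (auto simp: abs_mult simp del: times_divide_eq_right intro!: mult_left_mono code_bounded)
qed

sublocale code: real_distribution code_distr
  unfolding code_distr_def by (rule P.real_distribution_distr) measurable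

lemma char_code: "char code_distr \<xi> = (\<integral>\<omega>. iexp (\<xi> * code \<omega>) \<partial>S)"
  unfolding char_def code_distr_def by (rule integral_distr) measurable

lemma integral_first_letter:
  fixes h :: "'i \<Rightarrow> complex"
  shows "(\<integral>\<omega>. h (\<omega> 0) \<partial>S) = (\<integral>i. h i \<partial>measure_pmf p)"
proof -
  have "(\<integral>i. h i \<partial>measure_pmf p) = (\<integral>i. h i \<partial>distr S (measure_pmf p) (\<lambda>\<omega>. \<omega> 0))"
    using PiM_component[of 0] by simp
  also have "\<dots> = (\<integral>\<omega>. h (\<omega> 0) \<partial>S)"
    by (rule integral_distr[OF measurable_component_singleton]) auto
  finally show ?thesis by simp
qed

lemma char_code_self_similar:
  "char code_distr \<xi> = (\<integral>i. iexp (\<xi> * t i) * char code_distr (s powr (- \<alpha> i) * \<xi>) \<partial>measure_pmf p)"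
proof -
  have split: "iexp (\<xi> * code (comb_seq 1 \<omega> \<omega>')) =
      iexp (\<xi> * t (\<omega> 0)) * iexp (s powr (- \<alpha> (\<omega> 0)) * \<xi> * code \<omega>')" for \<omega> \<omega>'
    unfolding code_comb_seq using s by (simp add: partial_code_def walk_def distrib_left exp_add mult_ac)
  have "char code_distr \<xi> = (\<integral>\<omega>. \<integral>\<omega>'. iexp (\<xi> * code (comb_seq 1 \<omega> \<omega>')) \<partial>S \<partial>S)"
    unfolding char_code by (rule integral_comb_seq[where B = 1]) auto
  also have "\<dots> = (\<integral>\<omega>. iexp (\<xi> * t (\<omega> 0)) * char code_distr (s powr (- \<alpha> (\<omega> 0)) * \<xi>) \<partial>S)"
    unfolding split char_code by simp
  also have "\<dots> = (\<integral>i. iexp (\<xi> * t i) * char code_distr (s powr (- \<alpha> i) * \<xi>) \<partial>measure_pmf p)"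
    by (rule integral_first_letter)
  finally show ?thesis .
qed

text \<open>
  With \<open>e n = iexp (b * walk n \<omega>)\<close> and \<open>\<phi>\<close> its one-step mean, \<open>e (n + 1) - \<phi> * e n\<close> is a martingale difference,
  and its sum is \<open>1 - \<phi>\<close> times the sum of \<open>e n\<close> up to a bounded term. In particular \<open>\<bar>\<phi>\<bar> = 1\<close> is harmless.
\<close>

lemma walk_weyl_sum:
  assumes "(\<integral>i. iexp (b * \<alpha> i) \<partial>measure_pmf p) \<noteq> 1"
  shows "AE \<omega> in S. (\<lambda>N. (\<Sum>n<N. iexp (b * walk (Suc n) \<omega>)) / of_nat N) \<longlonglongrightarrow> 0"
proof -
  define \<phi> where "\<phi> = (\<integral>i. iexp (b * \<alpha> i) \<partial>measure_pmf p)"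
  define e where "e n \<omega> = iexp (b * walk n \<omega>)" for n \<omega>
  \<comment> \<open>The index is one higher than in the description above, because the sums wanted
    are those of \<open>walk (Suc n)\<close>.\<close>
  define X where "X n \<omega> = e (Suc (Suc n)) \<omega> - \<phi> * e (Suc n) \<omega>" for n \<omega>
  have \<phi>1: "cmod \<phi> \<le> 1"
    unfolding \<phi>_def by (rule measure_pmf.norm_expectation_le) simp
  have e1: "cmod (e n \<omega>) = 1" for n \<omega> by (simp add: e_def)
  have [measurable]: "e n \<in> borel_measurable S" for n unfolding e_def by measurable
  have [measurable]: "X n \<in> borel_measurable S" for n unfolding X_def by measurable
  have "AE \<omega> in S. (\<lambda>N. (\<Sum>n<N. X n \<omega>) / of_nat N) \<longlonglongrightarrow> 0"
  \<comment> \<open>\<open>X n\<close> sees \<open>n + 2\<close> letters, no more than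
    \<open>l + 1\<close> for \<open>n < l\<close>, and is centred given \<open>n + 1\<close>. It is
    its own proxy without error, so \<open>C = 0\<close> and \<open>r = 0\<close> are
    possible.\<close>
  proof (rule strong_law_martingale_differences[where B = 2 and d = 1 and V = "\<lambda>n l. X n" and C = 0 and r = 0])
    fix n \<omega>
    have "cmod (\<phi> * e (Suc n) \<omega>) \<le> 1" using \<phi>1 by (simp add: norm_mult e1)
    then show "cmod (X n \<omega>) \<le> 2"
      using norm_triangle_ineq4[of "e (Suc (Suc n)) \<omega>" "\<phi> * e (Suc n) \<omega>"] e1 by (simp add: X_def)
    have "X n (comb_seq (Suc n) \<omega> \<omega>') = e (Suc n) \<omega> * (iexp (b * \<alpha> (\<omega>' 0)) - \<phi>)" for \<omega>'
    proof -
      have "walk (Suc (Suc n)) (comb_seq (Suc n) \<omega> \<omega>') = walk (Suc n) \<omega> + \<alpha> (\<omega>' 0)"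
        using walk_comb_seq_add[of "Suc n" 1 \<omega> \<omega>'] by (simp add: walk_def)
      then show ?thesis
        by (simp add: X_def e_def walk_comb_seq distrib_left right_diff_distrib exp_add)
    qed
    moreover have "(\<integral>\<omega>'. iexp (b * \<alpha> (\<omega>' 0)) - \<phi> \<partial>S) = 0"
      using integral_first_letter[of "\<lambda>i. iexp (b * \<alpha> i)"]
      by (subst Bochner_Integration.integral_diff) (auto simp: \<phi>_def P.prob_space intro!: P.integrable_iexp)
    ultimately show "(\<integral>\<omega>'. X n (comb_seq (n + 1) \<omega> \<omega>') \<partial>S) = 0" by simp
  next
    fix n l :: nat and \<omega> \<omega>' assume "n < l"
    then show "X n (comb_seq (l + 1) \<omega> \<omega>') = X n \<omega>"
      by (simp add: X_def e_def walk_comb_seq)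
  qed auto
  then show ?thesis
  proof eventually_elim
    case (elim \<omega>)
    have sum: "(\<Sum>n<N. X n \<omega>) = (1 - \<phi>) * (\<Sum>n<N. e (Suc n) \<omega>) + (e (Suc N) \<omega> - e 1 \<omega>)" for N
      by (induction N) (auto simp: X_def algebra_simps)
    have "(\<lambda>N. (e (Suc N) \<omega> - e 1 \<omega>) / of_nat N) \<longlonglongrightarrow> 0"
    proof (rule Lim_null_comparison)
      show "\<forall>\<^sub>F N in sequentially. cmod ((e (Suc N) \<omega> - e 1 \<omega>) / of_nat N) \<le> 2 / real N"
        using norm_triangle_ineq4[of "e (Suc _) \<omega>" "e 1 \<omega>"]
        by (intro always_eventually) (auto simp: norm_divide e1 intro!: divide_right_mono)
      show "(\<lambda>N. 2 / real N) \<longlonglongrightarrow> 0"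
        by (rule real_tendsto_divide_at_top[OF tendsto_const filterlim_real_sequentially])
    qed
    from tendsto_divide[OF tendsto_diff[OF elim this] tendsto_const[of "1 - \<phi>"]] assms
    have "(\<lambda>N. ((\<Sum>n<N. X n \<omega>) / of_nat N - (e (Suc N) \<omega> - e 1 \<omega>) / of_nat N) / (1 - \<phi>)) \<longlonglongrightarrow> 0"
      by (simp add: \<phi>_def)
    moreover have "((\<Sum>n<N. X n \<omega>) / of_nat N - (e (Suc N) \<omega> - e 1 \<omega>) / of_nat N) / (1 - \<phi>) =
        (\<Sum>n<N. e (Suc n) \<omega>) / of_nat N" for N
      using assms unfolding sum by (simp add: \<phi>_def flip: diff_divide_distrib)
    ultimately show ?case by (simp add: e_def)
  qed
qed

lemma walk_equidistributed:
  assumes "\<And>q::int. q \<noteq> 0 \<Longrightarrow> (\<integral>i. iexp (2 * pi * of_int q * \<alpha> i) \<partial>measure_pmf p) \<noteq> 1"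
  shows "AE \<omega> in S. equidistributed_mod_1 (\<lambda>n. walk (Suc n) \<omega>)"
proof -
  have "AE \<omega> in S. \<forall>q::int. q \<noteq> 0 \<longrightarrow>
      (\<lambda>N. (\<Sum>n<N. iexp (2 * pi * of_int q * walk (Suc n) \<omega>)) / of_nat N) \<longlonglongrightarrow> 0"
    unfolding AE_all_countable
  proof
    fix q :: int
    show "AE \<omega> in S. q \<noteq> 0 \<longrightarrow>
      (\<lambda>N. (\<Sum>n<N. iexp (2 * pi * of_int q * walk (Suc n) \<omega>)) / of_nat N) \<longlonglongrightarrow> 0"
      using walk_weyl_sum[OF assms, of q] by (cases "q = 0") auto
  qed
  then show ?thesis
    by eventually_elim (rule weyl_criterion, simp add: vanishing_weyl_sums_def)
qed

end

section \<open>Block decomposition of the exponential sums\<close>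

text \<open>The constant may depend on \<open>e\<close>; it will absorb an incomplete last block,
  the first \<open>D\<close> terms and finitely many exceptional averages.\<close>

lemma average_tendsto_0I:
  fixes f :: "nat \<Rightarrow> complex"
  assumes "\<And>e. e > 0 \<Longrightarrow> \<exists>C. \<forall>K. cmod (\<Sum>k<K. f k) \<le> e * real K + C"
  shows "(\<lambda>K. (\<Sum>k<K. f k) / of_nat K) \<longlonglongrightarrow> 0"
proof (rule LIMSEQ_I)
  fix e :: real assume "e > 0"
  then obtain C where C: "\<And>K. cmod (\<Sum>k<K. f k) \<le> e / 2 * real K + C"
    using assms[of "e / 2"] by auto
  have "(\<lambda>K. C / real K) \<longlonglongrightarrow> 0"
    by (rule real_tendsto_divide_at_top[OF tendsto_const filterlim_real_sequentially])
  then have "\<forall>\<^sub>F K in sequentially. C / real K < e / 2"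
    by (rule order_tendstoD) (use \<open>e > 0\<close> in simp)
  then have "\<forall>\<^sub>F K in sequentially. norm ((\<Sum>k<K. f k) / of_nat K - 0) < e"
    using eventually_gt_at_top[of 0]
  proof eventually_elim
    case (elim K)
    have "cmod (\<Sum>k<K. f k) / real K \<le> (e / 2 * real K + C) / real K"
      by (intro divide_right_mono C) auto
    also have "\<dots> = e / 2 + C / real K" using elim by (simp add: field_simps)
    finally have "cmod (\<Sum>k<K. f k) / real K < e" using elim(1) by linarith
    then show ?case by (simp add: norm_divide)
  qed
  then show "\<exists>K0. \<forall>K\<ge>K0. norm ((\<Sum>k<K. f k) / of_nat K - 0) < e"
    by (simp add: eventually_sequentially)
qed

lemma sum_le_if_average_tendsto:
  fixes f :: "nat \<Rightarrow> real"
  assumes "(\<lambda>N. f N / real N) \<longlonglongrightarrow> l" "l < e"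
  obtains C where "0 \<le> C" "\<And>N. f N \<le> e * real N + C"
proof -
  from order_tendstoD(2)[OF assms] obtain N0 where N0: "\<And>N. N \<ge> N0 \<Longrightarrow> f N / real N < e"
    by (auto simp: eventually_sequentially)
  define C where "C = (\<Sum>N\<le>N0. \<bar>f N - e * real N\<bar>)"
  show thesis
  proof (rule that)
    show "0 \<le> C" unfolding C_def by (intro sum_nonneg) auto
    fix N
    show "f N \<le> e * real N + C"
    proof (cases "N \<le> N0")
      case True
      have "\<bar>f N - e * real N\<bar> \<le> C"
        unfolding C_def by (rule member_le_sum) (use True in auto)
      then show ?thesis by linarith
    next
      case False
      then have "f N < e * real N" using N0[of N] by (simp add: field_simps)
      with \<open>0 \<le> C\<close> show ?thesis by linarith
    qed
  qed
qed

text \<open>The bijection is \<open>k = \<lfloor>A'\<rfloor> - j\<close>, and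
  \<open>j \<le> J\<close> suffices because the block has length at most \<open>J\<close>. Rounding
  both ends up makes consecutive blocks abut; \<open>0 \<le> A\<close> keeps the conversions to
  \<open>nat\<close> faithful.\<close>

lemma sum_block_reindex:
  fixes F :: "real \<Rightarrow> 'b::comm_semiring_1"
  assumes A: "0 \<le> A" "A \<le> A'" "A' \<le> A + real J"
  shows "(\<Sum>j\<le>J. of_bool (A \<le> of_int \<lfloor>A'\<rfloor> - real j \<and> of_int \<lfloor>A'\<rfloor> - real j < A') * F (of_int \<lfloor>A'\<rfloor> - real j))
    = (\<Sum>k\<in>{nat \<lceil>A\<rceil>..<nat \<lceil>A'\<rceil>}. F (real k))"
proof -
  let ?P = "\<lambda>j. A \<le> of_int \<lfloor>A'\<rfloor> - real j \<and> of_int \<lfloor>A'\<rfloor> - real j < A'"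
  have "(\<Sum>j\<le>J. of_bool (?P j) * F (of_int \<lfloor>A'\<rfloor> - real j)) = (\<Sum>j\<in>{j\<in>{..J}. ?P j}. F (of_int \<lfloor>A'\<rfloor> - real j))"
    unfolding sum.inter_filter[OF finite_atMost] by (intro sum.cong) auto
  also have "\<dots> = (\<Sum>k\<in>{nat \<lceil>A\<rceil>..<nat \<lceil>A'\<rceil>}. F (real k))"
  proof (rule sum.reindex_bij_witness[where i = "\<lambda>k. nat (\<lfloor>A'\<rfloor> - int k)" and j = "\<lambda>j. nat (\<lfloor>A'\<rfloor> - int j)"])
    fix j assume j: "j \<in> {j\<in>{..J}. ?P j}"
    then have "0 \<le> real_of_int (\<lfloor>A'\<rfloor> - int j)" using A by simp
    then have nn: "0 \<le> \<lfloor>A'\<rfloor> - int j" by linarith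
    then show "nat (\<lfloor>A'\<rfloor> - int (nat (\<lfloor>A'\<rfloor> - int j))) = j" by simp
    show "F (real (nat (\<lfloor>A'\<rfloor> - int j))) = F (of_int \<lfloor>A'\<rfloor> - real j)" using nn by simp
    have "\<lceil>A\<rceil> \<le> \<lfloor>A'\<rfloor> - int j" using j by (simp add: ceiling_le_iff)
    moreover have "\<lfloor>A'\<rfloor> - int j < \<lceil>A'\<rceil>" using j by (simp add: less_ceiling_iff)
    moreover have "nat x \<in> {nat y..<nat z}" if "y \<le> x" "x < z" "0 \<le> x" for x y z :: int
      using that by auto
    ultimately show "nat (\<lfloor>A'\<rfloor> - int j) \<in> {nat \<lceil>A\<rceil>..<nat \<lceil>A'\<rceil>}" using nn by blast
  next
    fix k assume k: "k \<in> {nat \<lceil>A\<rceil>..<nat \<lceil>A'\<rceil>}"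
    then have 1: "A \<le> real k" by (simp add: nat_le_iff ceiling_le_iff)
    have 2: "real k < A'" using k by (auto simp: zless_nat_eq_int_zless less_ceiling_iff)
    then have 3: "int k \<le> \<lfloor>A'\<rfloor>" by (simp add: le_floor_iff)
    then show "nat (\<lfloor>A'\<rfloor> - int (nat (\<lfloor>A'\<rfloor> - int k))) = k" by simp
    have "real_of_int \<lfloor>A'\<rfloor> - real k \<le> real J" using 1 A by linarith
    then have "\<lfloor>A'\<rfloor> - int k \<le> int J" by linarith
    then show "nat (\<lfloor>A'\<rfloor> - int k) \<in> {j\<in>{..J}. ?P j}" using 1 2 3 by (simp add: nat_le_iff)
  qed
  finally show ?thesis .
qed

section \<open>Block sums and their conditional means\<close>

context bernoulli_coding
begin

text \<open>
  The \<open>j\<close>-th time of the \<open>n\<close>-th block is \<open>\<lfloor>walk (Suc n) \<omega>\<rfloor> - j\<close>. Counting down from the end of the block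
  keeps the index set \<open>{..J}\<close> independent of \<open>\<omega>\<close>; the guard removes the times before the block, and
  the time \<open>walk (Suc n) \<omega>\<close> itself when it is an integer.
\<close>

definition in_block :: "nat \<Rightarrow> (nat \<Rightarrow> 'i) \<Rightarrow> nat \<Rightarrow> bool" where
  "in_block n \<omega> j \<longleftrightarrow> walk n \<omega> \<le> of_int \<lfloor>walk (Suc n) \<omega>\<rfloor> - real j \<and>
     of_int \<lfloor>walk (Suc n) \<omega>\<rfloor> - real j < walk (Suc n) \<omega>"

definition block_freq :: "real \<Rightarrow> nat \<Rightarrow> nat \<Rightarrow> (nat \<Rightarrow> 'i) \<Rightarrow> nat \<Rightarrow> real" where
  "block_freq \<kappa> D n \<omega> j = \<kappa> * s powr (real D + (of_int \<lfloor>walk (Suc n) \<omega>\<rfloor> - real j))"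

text \<open>The point \<open>x\<close> is separate from the word that determines the block, so that
  the code can be replaced by its truncation.\<close>

definition block_sum :: "real \<Rightarrow> nat \<Rightarrow> nat \<Rightarrow> (nat \<Rightarrow> 'i) \<Rightarrow> real \<Rightarrow> complex" where
  "block_sum \<kappa> D n \<omega> x = (\<Sum>j\<le>J. of_bool (in_block n \<omega> j) * iexp (block_freq \<kappa> D n \<omega> j * x))"

definition block_mean :: "real \<Rightarrow> nat \<Rightarrow> nat \<Rightarrow> (nat \<Rightarrow> 'i) \<Rightarrow> complex" where
  "block_mean \<kappa> D n \<omega> = (\<Sum>j\<le>J. of_bool (in_block n \<omega> j) *
     (iexp (block_freq \<kappa> D n \<omega> j * partial_code (Suc n) \<omega>) *
      char code_distr (block_freq \<kappa> D n \<omega> j * s powr (- walk (Suc n) \<omega>))))"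

lemma measurable_in_block [measurable]: "Measurable.pred S (\<lambda>\<omega>. in_block n \<omega> j)"
  unfolding in_block_def by measurable

lemma measurable_block_freq [measurable]: "(\<lambda>\<omega>. block_freq \<kappa> D n \<omega> j) \<in> borel_measurable S"
  unfolding block_freq_def by measurable

lemma measurable_block_sum [measurable]:
  assumes [measurable]: "f \<in> borel_measurable S"
  shows "(\<lambda>\<omega>. block_sum \<kappa> D n \<omega> (f \<omega>)) \<in> borel_measurable S"
  unfolding block_sum_def of_bool_def by measurable

lemma measurable_block_mean [measurable]: "block_mean \<kappa> D n \<in> borel_measurable S"
  unfolding block_mean_def of_bool_def by measurable

lemma block_comb_seq:
  assumes "n < l"
  shows "block_sum \<kappa> D n (comb_seq l \<omega> \<omega>') = block_sum \<kappa> D n \<omega>"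
    and "block_mean \<kappa> D n (comb_seq l \<omega> \<omega>') = block_mean \<kappa> D n \<omega>"
  using assms
  by (auto simp: block_sum_def[abs_def] block_mean_def in_block_def block_freq_def walk_comb_seq partial_code_comb_seq)

lemma norm_block_sum: "cmod (block_sum \<kappa> D n \<omega> x) \<le> real (Suc J)"
proof -
  have "cmod (block_sum \<kappa> D n \<omega> x) \<le> (\<Sum>j\<le>J. 1)"
    unfolding block_sum_def by (intro sum_norm_le) (auto simp: norm_mult)
  then show ?thesis by simp
qed

lemma norm_block_mean: "cmod (block_mean \<kappa> D n \<omega>) \<le> real (Suc J)"
proof -
  have "cmod (block_mean \<kappa> D n \<omega>) \<le> (\<Sum>j\<le>J. 1)"
    unfolding block_mean_def by (intro sum_norm_le) (auto simp: norm_mult code.cmod_char_le_1)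
  then show ?thesis by simp
qed

text \<open>The integer part of the walk cancels; only here does the walk modulo 1 replace the walk
  itself.\<close>

lemma block_freq_scaled:
  "block_freq \<kappa> D n \<omega> j * s powr (- walk (Suc n) \<omega>) = \<kappa> * s powr (real D - real j - frac (walk (Suc n) \<omega>))"
  using s by (simp add: block_freq_def frac_def powr_add[symmetric] mult.assoc) (simp add: algebra_simps)

lemma block_mean_le:
  "cmod (block_mean \<kappa> D n \<omega>) \<le>
     (\<Sum>j\<le>J. cmod (char code_distr (\<kappa> * s powr (real D - real j - frac (walk (Suc n) \<omega>)))))"
  unfolding block_mean_def block_freq_scaled
  by (intro sum_norm_le) (auto simp: norm_mult)

text \<open>At most \<open>J + 1\<close> exponentials occur, and no time of the block exceeds
  \<open>walk (Suc n) \<omega>\<close>, which bounds every frequency.\<close>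

lemma block_sum_Lipschitz:
  "cmod (block_sum \<kappa> D n \<omega> x - block_sum \<kappa> D n \<omega> y) \<le>
     real (Suc J) * (\<bar>\<kappa>\<bar> * s powr (real D + walk (Suc n) \<omega>)) * \<bar>x - y\<bar>"
proof -
  have "cmod (block_sum \<kappa> D n \<omega> x - block_sum \<kappa> D n \<omega> y) \<le>
      (\<Sum>j\<le>J. (\<bar>\<kappa>\<bar> * s powr (real D + walk (Suc n) \<omega>)) * \<bar>x - y\<bar>)"
    unfolding block_sum_def sum_subtractf[symmetric] right_diff_distrib[symmetric]
  proof (rule sum_norm_le)
    fix j
    let ?f = "block_freq \<kappa> D n \<omega> j"
    have "cmod (of_bool (in_block n \<omega> j) * (iexp (?f * x) - iexp (?f * y))) \<le> cmod (iexp (?f * x) - iexp (?f * y))"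
      by (simp add: norm_mult)
    also have "\<dots> \<le> \<bar>?f\<bar> * \<bar>x - y\<bar>"
      using cmod_iexp_diff_le[of "?f * x" "?f * y"] by (simp add: abs_mult flip: right_diff_distrib)
    also have "\<bar>?f\<bar> \<le> \<bar>\<kappa>\<bar> * s powr (real D + walk (Suc n) \<omega>)"
    proof -
      have "of_int \<lfloor>walk (Suc n) \<omega>\<rfloor> - real j \<le> walk (Suc n) \<omega>" by linarith
      then show ?thesis
        using s by (auto simp: block_freq_def abs_mult intro!: mult_left_mono powr_mono)
    qed
    finally show "cmod (of_bool (in_block n \<omega> j) * (iexp (?f * x) - iexp (?f * y))) \<le>
        (\<bar>\<kappa>\<bar> * s powr (real D + walk (Suc n) \<omega>)) * \<bar>x - y\<bar>"
      by (simp add: mult_right_mono)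
  qed
  then show ?thesis by (simp add: mult_ac)
qed

text \<open>Given \<open>n + 1\<close> letters the block is fixed and the point is an affine image
  of an independent code, so each exponential integrates to a value of the characteristic
  function.\<close>

lemma block_sum_conditional_mean:
  "(\<integral>\<omega>'. block_sum \<kappa> D n \<omega> (partial_code (Suc n) \<omega> + s powr (- walk (Suc n) \<omega>) * code \<omega>') \<partial>S) = block_mean \<kappa> D n \<omega>"
proof -
  have int: "integrable S (\<lambda>\<omega>'. c * iexp (u * code \<omega>'))" for c u
    by (intro integrable_mult_right P.integrable_iexp) auto
  have split: "of_bool (in_block n \<omega> j) * iexp (block_freq \<kappa> D n \<omega> j * (partial_code (Suc n) \<omega> + s powr (- walk (Suc n) \<omega>) * code \<omega>')) =
      (of_bool (in_block n \<omega> j) * iexp (block_freq \<kappa> D n \<omega> j * partial_code (Suc n) \<omega>)) *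
        iexp (block_freq \<kappa> D n \<omega> j * s powr (- walk (Suc n) \<omega>) * code \<omega>')" for j \<omega>'
    by (simp add: distrib_left exp_add mult_ac)
  show ?thesis
    unfolding block_sum_def block_mean_def split char_code
    by (subst Bochner_Integration.integral_sum[OF int]) (simp add: mult.assoc)
qed

text \<open>The Lipschitz constant grows like \<open>s powr walk (Suc n) \<omega>\<close>, the
  truncation error decays like \<open>s powr (- walk (Suc l) \<omega>)\<close>, and the walk gains
  at least \<open>a\<close> per step: this is the rate \<open>r ^ (l - n)\<close>.\<close>

lemma block_fluctuation:
  "AE \<omega> in S. (\<lambda>N. (\<Sum>n<N. block_sum \<kappa> D n \<omega> (code \<omega>) - block_mean \<kappa> D n \<omega>) / of_nat N) \<longlonglongrightarrow> 0"
proof (rule strong_law_martingale_differences[where B = "2 * real (Suc J)" and d = 1 and r = r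
      and V = "\<lambda>n l \<omega>. block_sum \<kappa> D n \<omega> (partial_code (Suc l) \<omega>) - block_mean \<kappa> D n \<omega>"
      and C = "real (Suc J) * (\<bar>\<kappa>\<bar> * s powr real D) * (\<tau> / (1 - r))"])
  fix n \<omega>
  show "cmod (block_sum \<kappa> D n \<omega> (code \<omega>) - block_mean \<kappa> D n \<omega>) \<le> 2 * real (Suc J)"
    unfolding mult_2 by (rule order_trans[OF norm_triangle_ineq4 add_mono[OF norm_block_sum norm_block_mean]])
  have "integrable S (\<lambda>\<omega>'. block_sum \<kappa> D n \<omega> (partial_code (Suc n) \<omega> + s powr (- walk (Suc n) \<omega>) * code \<omega>'))"
    by (rule P.integrable_const_bound[where B = "real (Suc J)"])
      (auto simp: norm_block_sum simp del: of_nat_Suc, unfold block_sum_def, measurable)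
  then show "(\<integral>\<omega>'. block_sum \<kappa> D n (comb_seq (n + 1) \<omega> \<omega>') (code (comb_seq (n + 1) \<omega> \<omega>')) -
      block_mean \<kappa> D n (comb_seq (n + 1) \<omega> \<omega>') \<partial>S) = 0"
    by (simp add: block_comb_seq code_comb_seq block_sum_conditional_mean P.prob_space)
next
  fix n l :: nat and \<omega> \<omega>' assume nl: "n < l"
  then show "block_sum \<kappa> D n (comb_seq (l + 1) \<omega> \<omega>') (partial_code (Suc l) (comb_seq (l + 1) \<omega> \<omega>')) -
      block_mean \<kappa> D n (comb_seq (l + 1) \<omega> \<omega>') =
      block_sum \<kappa> D n \<omega> (partial_code (Suc l) \<omega>) - block_mean \<kappa> D n \<omega>"
    by (simp add: block_comb_seq partial_code_comb_seq)
  let ?w = "walk (Suc n) \<omega>" and ?w' = "walk (Suc l) \<omega>"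
  \<comment> \<open>The bound at any letter shows that \<open>\<tau>\<close> is nonnegative.\<close>
  have \<tau>: "0 \<le> \<tau> / (1 - r)" using r t_bound[of undefined] by (intro divide_nonneg_nonneg) auto
  have "cmod (block_sum \<kappa> D n \<omega> (code \<omega>) - block_sum \<kappa> D n \<omega> (partial_code (Suc l) \<omega>)) \<le>
      real (Suc J) * (\<bar>\<kappa>\<bar> * s powr (real D + ?w)) * \<bar>code \<omega> - partial_code (Suc l) \<omega>\<bar>"
    by (rule block_sum_Lipschitz)
  also have "\<dots> \<le> real (Suc J) * (\<bar>\<kappa>\<bar> * s powr (real D + ?w)) * (s powr (- ?w') * (\<tau> / (1 - r)))"
    by (intro mult_left_mono code_partial_code) auto
  also have "\<dots> = real (Suc J) * (\<bar>\<kappa>\<bar> * s powr real D) * (\<tau> / (1 - r)) * s powr (?w - ?w')"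
    using s by (simp add: powr_add powr_diff powr_minus divide_inverse mult_ac)
  also have "\<dots> \<le> real (Suc J) * (\<bar>\<kappa>\<bar> * s powr real D) * (\<tau> / (1 - r)) * r ^ (l - n)"
  proof (intro mult_left_mono)
    have "?w - ?w' \<le> - a * real (l - n)" using walk_mono[of "Suc n" "Suc l" \<omega>] nl by simp
    then have "s powr (?w - ?w') \<le> s powr (- a * real (l - n))" using s by (intro powr_mono) auto
    also have "\<dots> = r ^ (l - n)" using r(1) by (simp add: powr_realpow[symmetric] powr_powr)
    finally show "s powr (?w - ?w') \<le> r ^ (l - n)" .
  qed (use \<tau> in \<open>auto simp del: times_divide_eq_right intro!: mult_nonneg_nonneg\<close>)
  finally show "cmod (block_sum \<kappa> D n \<omega> (code \<omega>) - block_mean \<kappa> D n \<omega> -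
      (block_sum \<kappa> D n \<omega> (partial_code (Suc l) \<omega>) - block_mean \<kappa> D n \<omega>)) \<le>
      real (Suc J) * (\<bar>\<kappa>\<bar> * s powr real D) * (\<tau> / (1 - r)) * r ^ (l - n)"
    by simp
qed (use r in auto)

lemma sum_block_sum:
  "(\<Sum>n<N. block_sum \<kappa> D n \<omega> x) = (\<Sum>k<nat \<lceil>walk N \<omega>\<rceil>. iexp (\<kappa> * s powr (real D + real k) * x))"
proof (induction N)
  case 0
  then show ?case by (simp add: walk_def)
next
  case (Suc N)
  let ?F = "\<lambda>k. iexp (\<kappa> * s powr (real D + real k) * x)"
  have w: "0 \<le> walk N \<omega>" "walk N \<omega> \<le> walk (Suc N) \<omega>" "walk (Suc N) \<omega> \<le> walk N \<omega> + real J"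
    using walk_ge[of N \<omega>] walk_mono[of N "Suc N" \<omega>] walk_Suc_le[of N \<omega>] a
    by (auto intro: order_trans[of 0 "a * real N"])
  then have le: "nat \<lceil>walk N \<omega>\<rceil> \<le> nat \<lceil>walk (Suc N) \<omega>\<rceil>" by (intro nat_mono ceiling_mono)
  have "block_sum \<kappa> D N \<omega> x = (\<Sum>k\<in>{nat \<lceil>walk N \<omega>\<rceil>..<nat \<lceil>walk (Suc N) \<omega>\<rceil>}. ?F k)"
    unfolding block_sum_def in_block_def block_freq_def
    using sum_block_reindex[OF w, of "\<lambda>u. iexp (\<kappa> * s powr (real D + u) * x)"] .
  then show ?case
    using Suc sum.atLeastLessThan_concat[OF _ le, of 0 ?F] by (simp add: lessThan_atLeast0)
qed

text \<open>The error is counted per block, and \<open>N\<close> blocks cover at least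
  \<open>a * N\<close> times. A budget of \<open>a * e / 4\<close> per block for each of three
  sources therefore gives slope \<open>3 / 4 * e\<close> in time.\<close>

lemma code_weyl_sum:
  assumes equi: "AE \<omega> in S. equidistributed_mod_1 (\<lambda>n. walk (Suc n) \<omega>)"
    and atomless: "\<And>z. measure code_distr {z} = 0" and \<kappa>: "\<kappa> \<noteq> 0"
  shows "AE \<omega> in S. (\<lambda>K. (\<Sum>k<K. iexp (\<kappa> * (s ^ k * code \<omega>))) / of_nat K) \<longlonglongrightarrow> 0"
proof -
  obtain L :: "nat \<Rightarrow> real" where L: "L \<longlonglongrightarrow> 0"
    and L': "\<And>x D. equidistributed_mod_1 x \<Longrightarrow>
      (\<lambda>N. (\<Sum>k<N. (cmod (char code_distr (\<kappa> * s powr (real D - frac (x k)))))\<^sup>2) / real N) \<longlonglongrightarrow> L D"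
    using code.wiener_along_equidistributed[OF atomless s \<kappa>] by blast
  have "AE \<omega> in S. \<forall>D. (\<lambda>N. (\<Sum>n<N. block_sum \<kappa> D n \<omega> (code \<omega>) - block_mean \<kappa> D n \<omega>) / of_nat N) \<longlonglongrightarrow> 0"
    unfolding AE_all_countable using block_fluctuation by blast
  with equi show ?thesis
  proof eventually_elim
    case (elim \<omega>)
    show ?case
    proof (rule average_tendsto_0I)
      fix e :: real assume "e > 0"
      \<comment> \<open>Chosen so that \<open>J + 1\<close> Fourier coefficients of size
        \<open>\<epsilon>\<close> use up one share \<open>a * e / 4\<close>.\<close>
      define \<epsilon> where "\<epsilon> = a * e / (4 * real (Suc J))"
      have \<epsilon>: "\<epsilon> > 0" using \<open>e > 0\<close> a by (simp add: \<epsilon>_def)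
      have "(\<lambda>D. \<Sum>j\<le>J. L (D + (J - j))) \<longlonglongrightarrow> (\<Sum>j\<le>J. 0)"
        by (intro tendsto_sum LIMSEQ_ignore_initial_segment L)
      then have "(\<lambda>D. (\<Sum>j\<le>J. L (D + (J - j))) / \<epsilon>) \<longlonglongrightarrow> 0"
        using tendsto_divide[OF _ tendsto_const[of \<epsilon>]] \<epsilon> by force
      then have "\<forall>\<^sub>F D in sequentially. (\<Sum>j\<le>J. L (D + (J - j))) / \<epsilon> < a * e / 4"
        by (rule order_tendstoD) (use a \<open>e > 0\<close> in simp)
      then obtain D0 where D0: "(\<Sum>j\<le>J. L (D0 + (J - j))) / \<epsilon> < a * e / 4"
        by (auto simp: eventually_sequentially)
      \<comment> \<open>The extra \<open>J\<close> keeps \<open>D - j\<close> a natural number, at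
        least \<open>D0\<close>, for every \<open>j \<le> J\<close>.\<close>
      define D where "D = D0 + J"
      define c where "c n j = cmod (char code_distr (\<kappa> * s powr (real D - real j - frac (walk (Suc n) \<omega>))))" for n j
      define Q where "Q N = (\<Sum>n<N. \<Sum>j\<le>J. (c n j)\<^sup>2) / \<epsilon>" for N
      have "(\<lambda>N. (\<Sum>j\<le>J. (\<Sum>n<N. (c n j)\<^sup>2) / real N) / \<epsilon>) \<longlonglongrightarrow> (\<Sum>j\<le>J. L (D0 + (J - j))) / \<epsilon>"
      proof (intro tendsto_divide tendsto_sum tendsto_const)
        fix j assume "j \<in> {..J}"
        then have "real D - real j = real (D0 + (J - j))" by (simp add: D_def of_nat_diff)
        then show "(\<lambda>N. (\<Sum>n<N. (c n j)\<^sup>2) / real N) \<longlonglongrightarrow> L (D0 + (J - j))"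
          using L'[OF elim(1), of "D0 + (J - j)"] by (simp only: c_def)
      qed (use \<epsilon> in auto)
      moreover have "(\<Sum>j\<le>J. (\<Sum>n<N. (c n j)\<^sup>2) / real N) / \<epsilon> = Q N / real N" for N
        unfolding Q_def by (subst sum.swap) (simp add: sum_divide_distrib mult.commute)
      ultimately have "(\<lambda>N. Q N / real N) \<longlonglongrightarrow> (\<Sum>j\<le>J. L (D0 + (J - j))) / \<epsilon>" by simp
      then obtain C1 where C1: "0 \<le> C1" "\<And>N. Q N \<le> a * e / 4 * real N + C1"
        using sum_le_if_average_tendsto[OF _ D0] by blast
      define Z where "Z N = cmod (\<Sum>n<N. block_sum \<kappa> D n \<omega> (code \<omega>) - block_mean \<kappa> D n \<omega>)" for N
      have "(\<lambda>N. Z N / real N) \<longlonglongrightarrow> 0"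
        using tendsto_norm_zero[OF elim(2)[rule_format, of D]] by (simp add: Z_def norm_divide)
      moreover have "0 < a * e / 4" using a \<open>e > 0\<close> by simp
      ultimately obtain C2 where C2: "0 \<le> C2" "\<And>N. Z N \<le> a * e / 4 * real N + C2"
        using sum_le_if_average_tendsto[of Z 0 "a * e / 4"] by blast
      have mean: "cmod (\<Sum>n<N. block_mean \<kappa> D n \<omega>) \<le> a * e / 4 * real N + Q N" for N
      proof -
        \<comment> \<open>Wiener's argument controls squares only; this splitting passes from
          squares to first powers.\<close>
        have c: "c n j \<le> \<epsilon> + (c n j)\<^sup>2 / \<epsilon>" for n j
        proof (cases "c n j \<le> \<epsilon>")
          case True
          then show ?thesis using \<epsilon> by (simp add: add_increasing2)
        next
          case False
          then have "c n j * \<epsilon> \<le> c n j * c n j" using \<epsilon> by (intro mult_left_mono) auto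
          then have "c n j \<le> (c n j)\<^sup>2 / \<epsilon>" using \<epsilon> by (simp add: field_simps power2_eq_square)
          then show ?thesis using \<epsilon> by simp
        qed
        have "cmod (\<Sum>n<N. block_mean \<kappa> D n \<omega>) \<le> (\<Sum>n<N. \<Sum>j\<le>J. \<epsilon> + (c n j)\<^sup>2 / \<epsilon>)"
        proof (rule sum_norm_le)
          fix n
          have "cmod (block_mean \<kappa> D n \<omega>) \<le> (\<Sum>j\<le>J. c n j)"
            unfolding c_def by (rule block_mean_le)
          also have "\<dots> \<le> (\<Sum>j\<le>J. \<epsilon> + (c n j)\<^sup>2 / \<epsilon>)" by (intro sum_mono c)
          finally show "cmod (block_mean \<kappa> D n \<omega>) \<le> (\<Sum>j\<le>J. \<epsilon> + (c n j)\<^sup>2 / \<epsilon>)" .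
        qed
        also have "\<dots> = real N * (real (Suc J) * \<epsilon>) + Q N"
          by (simp add: Q_def sum.distrib sum_divide_distrib)
        also have "real (Suc J) * \<epsilon> = a * e / 4" by (simp add: \<epsilon>_def del: of_nat_Suc)
        finally show ?thesis by (simp add: mult.commute)
      qed
      define f where "f k = iexp (\<kappa> * (s ^ k * code \<omega>))" for k
      have f1: "cmod (f k) = 1" for k by (simp add: f_def)
      define b where "b N = nat \<lceil>walk N \<omega>\<rceil>" for N
      have blocks: "cmod (\<Sum>k<b N. f (D + k)) \<le> 3 / 4 * a * e * real N + (C1 + C2)" for N
      proof -
        have "(\<Sum>k<b N. f (D + k)) = (\<Sum>n<N. block_sum \<kappa> D n \<omega> (code \<omega>))"
          unfolding sum_block_sum b_def f_def using s
          by (intro sum.cong) (auto simp: powr_add powr_realpow power_add mult_ac)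
        also have "\<dots> = (\<Sum>n<N. block_sum \<kappa> D n \<omega> (code \<omega>) - block_mean \<kappa> D n \<omega>) + (\<Sum>n<N. block_mean \<kappa> D n \<omega>)"
          by (simp add: sum_subtractf)
        finally have "cmod (\<Sum>k<b N. f (D + k)) \<le> Z N + cmod (\<Sum>n<N. block_mean \<kappa> D n \<omega>)"
          unfolding Z_def by (simp add: norm_triangle_ineq)
        with C1(2)[of N] C2(2)[of N] mean[of N] show ?thesis by (simp add: algebra_simps)
      qed
      have b0: "b 0 = 0" by (simp add: b_def walk_def)
      have b_ge: "a * real N \<le> real (b N)" for N
        unfolding b_def using walk_ge[of N \<omega>] by linarith
      have b_Suc: "real (b (Suc N)) \<le> real (b N) + real J" for N
      proof -
        have "\<lceil>walk (Suc N) \<omega>\<rceil> \<le> \<lceil>walk N \<omega>\<rceil> + int J"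
          using walk_Suc_le[of N \<omega>] by (simp add: ceiling_le_iff) linarith
        then show ?thesis unfolding b_def by linarith
      qed
      have shifted: "cmod (\<Sum>k<K. f (D + k)) \<le> 3 / 4 * e * real K + (C1 + C2 + real J)" for K
      proof -
        \<comment> \<open>Number of blocks completed by time \<open>K\<close>; the unfinished one
          has at most \<open>J\<close> terms.\<close>
        define N where "N = (GREATEST N. b N \<le> K)"
        have bd: "N \<le> nat \<lceil>real K / a\<rceil>" if "b N \<le> K" for N
        proof -
          have "a * real N \<le> real K" using b_ge[of N] that by linarith
          then have "real N \<le> real K / a" using a by (simp add: field_simps)
          then show ?thesis by linarith
        qed
        have N: "b N \<le> K"
          unfolding N_def by (rule GreatestI_nat[of _ 0]) (use b0 bd in auto)
        have "\<not> b (Suc N) \<le> K"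
          using Greatest_le_nat[of "\<lambda>N. b N \<le> K" "Suc N" "nat \<lceil>real K / a\<rceil>"] bd unfolding N_def by auto
        then have diff: "real K - real (b N) \<le> real J" using b_Suc[of N] by linarith
        have split: "(\<Sum>k<K. f (D + k)) = (\<Sum>k<b N. f (D + k)) + (\<Sum>k\<in>{b N..<K}. f (D + k))"
          using sum.atLeastLessThan_concat[OF _ N, of 0 "\<lambda>k. f (D + k)"] by (simp add: lessThan_atLeast0)
        have "cmod (\<Sum>k\<in>{b N..<K}. f (D + k)) \<le> real (card {b N..<K}) * 1"
          by (intro sum_norm_bound) (simp add: f1)
        then have "cmod (\<Sum>k\<in>{b N..<K}. f (D + k)) \<le> real J"
          using diff N by (simp add: of_nat_diff)
        then have "cmod (\<Sum>k<K. f (D + k)) \<le> 3 / 4 * a * e * real N + (C1 + C2) + real J"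
          unfolding split using blocks[of N] norm_triangle_ineq[of "\<Sum>k<b N. f (D + k)" "\<Sum>k\<in>{b N..<K}. f (D + k)"] by linarith
        moreover have "3 / 4 * e * (a * real N) \<le> 3 / 4 * e * real K"
          using b_ge[of N] N \<open>e > 0\<close> by (intro mult_left_mono) linarith+
        ultimately show ?thesis by (simp add: mult_ac)
      qed
      show "\<exists>C. \<forall>K. cmod (\<Sum>k<K. iexp (\<kappa> * (s ^ k * code \<omega>))) \<le> e * real K + C"
      proof (intro exI allI)
        fix K
        have small: "cmod (\<Sum>k<m. f k) \<le> real m" for m
          using sum_norm_bound[of "{..<m}" f 1] by (simp add: f1)
        have e0: "3 / 4 * e * real n \<le> e * real m" if "n \<le> m" for n m :: nat
          using that \<open>e > 0\<close> by (intro mult_mono) auto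
        have "cmod (\<Sum>k<K. f k) \<le> e * real K + (C1 + C2 + real J + real D)"
        proof (cases "K \<le> D")
          case True
          then show ?thesis using small[of K] e0[of 0 K] C1(1) C2(1) by (simp add: add_increasing)
        next
          case False
          \<comment> \<open>Undoing the shift costs at most \<open>D\<close> unimodular terms,
            absorbed in the constant.\<close>
          then have "(\<Sum>k<K. f k) = (\<Sum>k<D. f k) + (\<Sum>k<K - D. f (D + k))"
            using sum.atLeastLessThan_concat[of 0 D K f] sum.atLeastLessThan_shift_0[of f D K]
            by (simp add: lessThan_atLeast0 comp_def)
          then show ?thesis
            using norm_triangle_ineq[of "\<Sum>k<D. f k" "\<Sum>k<K - D. f (D + k)"] small[of D] shifted[of "K - D"] e0[of "K - D" K]
            by simp
        qed
        then show "cmod (\<Sum>k<K. iexp (\<kappa> * (s ^ k * code \<omega>))) \<le> e * real K + (C1 + C2 + real J + real D)"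
          by (simp add: f_def)
      qed
    qed
  qed
qed

theorem code_distr_pointwise_normal:
  assumes "\<And>q::int. q \<noteq> 0 \<Longrightarrow> (\<integral>i. iexp (2 * pi * of_int q * \<alpha> i) \<partial>measure_pmf p) \<noteq> 1"
    and "\<And>z. measure code_distr {z} = 0"
  shows "pointwise_normal s code_distr"
proof -
  let ?W = "\<lambda>x. \<forall>q::int. q \<noteq> 0 \<longrightarrow> (\<lambda>N. (\<Sum>k<N. iexp (2 * pi * of_int q * (s ^ k * x))) / of_nat N) \<longlonglongrightarrow> 0"
  \<comment> \<open>Transferring the almost sure statement from words to points needs a measurable
    predicate; vanishing of the Weyl sums is visibly one.\<close>
  have [measurable]: "Measurable.pred borel ?W" by measurable
  have "AE \<omega> in S. ?W (code \<omega>)"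
    unfolding AE_all_countable
  proof
    fix q :: int
    show "AE \<omega> in S. q \<noteq> 0 \<longrightarrow>
      (\<lambda>N. (\<Sum>k<N. iexp (2 * pi * of_int q * (s ^ k * code \<omega>))) / of_nat N) \<longlonglongrightarrow> 0"
      using code_weyl_sum[OF walk_equidistributed[OF assms(1)] assms(2), of "2 * pi * of_int q"]
      by (cases "q = 0") auto
  qed
  then have "AE x in code_distr. ?W x"
    unfolding code_distr_def by (subst AE_distr_iff) auto
  then show ?thesis
    unfolding pointwise_normal_def normal_number_def
    by eventually_elim (rule weyl_criterion, simp add: vanishing_weyl_sums_def)
qed

end

section \<open>Self-similar measures\<close>

text \<open>Self-similarity says that \<open>\<mu>\<close> is the law of
  \<open>\<rho> i * x + t i\<close> for independent \<open>i\<close> and \<open>x\<close>; Fubini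
  then gives the same functional equation as for the code.\<close>

lemma char_self_similar_measure:
  fixes p :: "'i pmf" and \<rho> t :: "'i \<Rightarrow> real"
  assumes "prob_space \<mu>" and sets_\<mu>: "sets \<mu> = sets borel"
    and \<mu>: "\<And>A. A \<in> sets borel \<Longrightarrow>
      measure \<mu> A = (\<integral>i. measure \<mu> ((\<lambda>x. \<rho> i * x + t i) -` A) \<partial>measure_pmf p)"
  shows "char \<mu> \<xi> = (\<integral>i. iexp (\<xi> * t i) * char \<mu> (\<rho> i * \<xi>) \<partial>measure_pmf p)"
proof -
  interpret \<mu>: prob_space \<mu> by fact
  interpret pair: pair_prob_space "measure_pmf p" \<mu> ..
  note [measurable_cong] = sets_\<mu>
  have space_\<mu>: "space \<mu> = UNIV" using sets_eq_imp_space_eq[OF sets_\<mu>] by simp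
  let ?f = "\<lambda>(i, x). \<rho> i * x + t i"
  have [measurable]: "?f \<in> borel_measurable (measure_pmf p \<Otimes>\<^sub>M \<mu>)"
  proof -
    have [measurable]: "(\<lambda>y. g (fst y)) \<in> borel_measurable (measure_pmf p \<Otimes>\<^sub>M \<mu>)" for g :: "'i \<Rightarrow> real"
      by (rule measurable_compose[OF measurable_fst]) simp
    then show ?thesis by (simp add: split_beta')
  qed
  have distr: "\<mu> = distr (measure_pmf p \<Otimes>\<^sub>M \<mu>) borel ?f"
  proof (rule measure_eqI)
    fix A assume "A \<in> sets \<mu>"
    then have A[measurable]: "A \<in> sets borel" by (simp add: sets_\<mu>)
    have "emeasure (distr (measure_pmf p \<Otimes>\<^sub>M \<mu>) borel ?f) A =
        emeasure (measure_pmf p \<Otimes>\<^sub>M \<mu>) (?f -` A \<inter> space (measure_pmf p \<Otimes>\<^sub>M \<mu>))"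
      by (rule emeasure_distr) auto
    also have "\<dots> = (\<integral>\<^sup>+i. emeasure \<mu> (Pair i -` (?f -` A \<inter> space (measure_pmf p \<Otimes>\<^sub>M \<mu>))) \<partial>measure_pmf p)"
      by (rule sigma_finite_measure.emeasure_pair_measure_alt[OF prob_space_imp_sigma_finite[OF \<open>prob_space \<mu>\<close>]]) (auto intro: measurable_sets)
    also have "\<dots> = (\<integral>\<^sup>+i. ennreal (measure \<mu> ((\<lambda>x. \<rho> i * x + t i) -` A)) \<partial>measure_pmf p)"
      by (intro nn_integral_cong) (auto simp: \<mu>.emeasure_eq_measure space_pair_measure space_\<mu> vimage_def)
    also have "\<dots> = ennreal (\<integral>i. measure \<mu> ((\<lambda>x. \<rho> i * x + t i) -` A) \<partial>measure_pmf p)"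
      by (rule nn_integral_eq_integral) (auto intro!: measure_pmf.integrable_const_bound[where B = 1])
    also have "\<dots> = emeasure \<mu> A" by (simp add: \<mu>[OF A] \<mu>.emeasure_eq_measure)
    finally show "emeasure \<mu> A = emeasure (distr (measure_pmf p \<Otimes>\<^sub>M \<mu>) borel ?f) A" by simp
  qed (simp add: sets_\<mu>)
  have "char \<mu> \<xi> = (\<integral>x. iexp (\<xi> * x) \<partial>distr (measure_pmf p \<Otimes>\<^sub>M \<mu>) borel ?f)"
    unfolding char_def by (subst distr) (rule refl)
  also have "\<dots> = (\<integral>y. iexp (\<xi> * ?f y) \<partial>(measure_pmf p \<Otimes>\<^sub>M \<mu>))"
    by (rule integral_distr) auto
  also have "\<dots> = (\<integral>(i, x). iexp (\<xi> * (\<rho> i * x + t i)) \<partial>(measure_pmf p \<Otimes>\<^sub>M \<mu>))"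
    by (simp only: split_beta')
  also have "\<dots> = (\<integral>i. \<integral>x. iexp (\<xi> * (\<rho> i * x + t i)) \<partial>\<mu> \<partial>measure_pmf p)"
  proof (rule pair.integral_fst[symmetric], rule pair.P.integrable_const_bound[where B = 1])
    have "(\<lambda>y. iexp (\<xi> * ?f y)) \<in> borel_measurable (measure_pmf p \<Otimes>\<^sub>M \<mu>)" by measurable
    then show "(\<lambda>(i, x). iexp (\<xi> * (\<rho> i * x + t i))) \<in> borel_measurable (measure_pmf p \<Otimes>\<^sub>M \<mu>)"
      by (simp only: split_beta')
  qed auto
  also have "\<dots> = (\<integral>i. iexp (\<xi> * t i) * char \<mu> (\<rho> i * \<xi>) \<partial>measure_pmf p)"
  proof -
    have "iexp (\<xi> * (\<rho> i * x + t i)) = iexp (\<xi> * t i) * iexp (\<rho> i * \<xi> * x)" for i x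
      by (simp add: distrib_left exp_add mult_ac)
    then show ?thesis by (simp only: char_def integral_mult_right_zero)
  qed
  finally show ?thesis .
qed

text \<open>More than \<open>1 / c\<close> such points would carry total mass above 1.\<close>

lemma (in prob_space) finite_heavy_points:
  assumes "c > 0" and "\<And>x. {x} \<in> events"
  shows "finite {x. c \<le> prob {x}}"
proof (rule ccontr)
  assume "infinite {x. c \<le> prob {x}}"
  then obtain F where F: "F \<subseteq> {x. c \<le> prob {x}}" "finite F" "card F = Suc (nat \<lceil>1 / c\<rceil>)"
    using infinite_arbitrarily_large by blast
  have "real (card F) * c = (\<Sum>x\<in>F. c)" by simp
  also have "\<dots> \<le> (\<Sum>x\<in>F. prob {x})" using F by (intro sum_mono) auto
  also have "\<dots> = prob F"
    using assms(2) F(2) by (intro finite_measure_eq_sum_singleton[symmetric]) auto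
  also have "\<dots> \<le> 1" by simp
  finally have "real (card F) \<le> 1 / c" using \<open>c > 0\<close> by (simp add: field_simps)
  then show False unfolding F(3) by linarith
qed

text \<open>
  The preimage under each map of a point of maximal mass has maximal mass as well; as there are
  only finitely many such points and the inverse maps are expanding, each map fixes such a point.
\<close>

lemma self_similar_atomless:
  fixes \<rho> t w :: "nat \<Rightarrow> real" and \<mu> :: "real measure"
  assumes "prob_space \<mu>" and M: "sets \<mu> = sets borel"
    and \<rho>: "\<And>i. i \<in> {1..m} \<Longrightarrow> 0 < \<rho> i \<and> \<rho> i < 1"
    and w: "\<And>i. i \<in> {1..m} \<Longrightarrow> 0 < w i" "(\<Sum>i=1..m. w i) = 1"
    and self_similar: "\<And>A. A \<in> sets borel \<Longrightarrow> measure \<mu> A = (\<Sum>i=1..m. w i * measure \<mu> (ifs_map \<rho> t i -` A))"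
    and no_fix: "\<nexists>x. \<forall>i\<in>{1..m}. ifs_map \<rho> t i x = x"
  shows "measure \<mu> {z} = 0"
proof (rule ccontr)
  interpret prob_space \<mu> by fact
  assume "measure \<mu> {z} \<noteq> 0"
  then have z: "measure \<mu> {z} > 0" by (simp add: zero_less_measure_iff)
  define F where "F = {x. measure \<mu> {z} \<le> measure \<mu> {x}}"
  have F: "finite F" "z \<in> F"
    unfolding F_def using finite_heavy_points[OF z] M by auto
  define c where "c = Max ((\<lambda>x. measure \<mu> {x}) ` F)"
  have c: "measure \<mu> {z} \<le> c" unfolding c_def using F by (intro Max_ge) auto
  have le_c: "measure \<mu> {x} \<le> c" for x
  proof (cases "x \<in> F")
    case True
    then show ?thesis unfolding c_def using F by (intro Max_ge) auto
  next
    case False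
    then show ?thesis using c by (simp add: F_def)
  qed
  define A where "A = {x. measure \<mu> {x} = c}"
  have "A \<subseteq> F" using c by (auto simp: A_def F_def)
  then have "finite A" using F finite_subset by blast
  have "c \<in> (\<lambda>x. measure \<mu> {x}) ` F" unfolding c_def using F by (intro Max_in) auto
  then have "A \<noteq> {}" by (auto simp: A_def)
  \<comment> \<open>The maximal mass \<open>c\<close> is an average, with positive weights, of
    masses at most \<open>c\<close>, so none of them can be smaller.\<close>
  have inv: "(x - t i) / \<rho> i \<in> A" if "x \<in> A" and i: "i \<in> {1..m}" for x i
  proof (rule ccontr)
    let ?y = "\<lambda>i. (x - t i) / \<rho> i"
    assume "?y i \<notin> A"
    then have lt: "measure \<mu> {?y i} < c" using le_c[of "?y i"] by (simp add: A_def)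
    have pre: "ifs_map \<rho> t j -` {x} = {?y j}" if "j \<in> {1..m}" for j
      using \<rho>[OF that] by (auto simp: ifs_map_def field_simps)
    have "c = (\<Sum>j=1..m. w j * measure \<mu> {?y j})"
      using self_similar[of "{x}"] \<open>x \<in> A\<close> pre by (simp add: A_def)
    also have "\<dots> < (\<Sum>j=1..m. w j * c)"
    proof (rule sum_strict_mono_ex1)
      show "\<forall>j\<in>{1..m}. w j * measure \<mu> {?y j} \<le> w j * c"
        using w(1) le_c by (auto intro!: mult_left_mono less_imp_le)
      show "\<exists>j\<in>{1..m}. w j * measure \<mu> {?y j} < w j * c"
        using i lt w(1)[OF i] by (intro bexI[of _ i]) (auto intro!: mult_strict_left_mono)
    qed simp
    also have "\<dots> = c" using w(2) by (simp flip: sum_distrib_right)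
    finally show False by simp
  qed
  have fixed: "ifs_map \<rho> t i x = x" if "x \<in> A" and i: "i \<in> {1..m}" for x i
  proof -
    \<comment> \<open>Fixed point of the map \<open>i\<close>. The point of \<open>A\<close>
      farthest from it would be moved farther by the inverse map unless
      \<open>d = 0\<close>.\<close>
    define f where "f = t i / (1 - \<rho> i)"
    have \<rho>i: "0 < \<rho> i" "\<rho> i < 1" using \<rho>[OF i] by auto
    define d where "d = Max ((\<lambda>y. \<bar>y - f\<bar>) ` A)"
    have "d \<in> (\<lambda>y. \<bar>y - f\<bar>) ` A" unfolding d_def using \<open>finite A\<close> \<open>A \<noteq> {}\<close> by (intro Max_in) auto
    then obtain y where y: "y \<in> A" "d = \<bar>y - f\<bar>" by auto
    have "(y - t i) / \<rho> i - f = (y - f) / \<rho> i"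
      using \<rho>i by (simp add: f_def field_simps)
    then have "\<bar>y - f\<bar> / \<rho> i = \<bar>(y - t i) / \<rho> i - f\<bar>" using \<rho>i by simp
    also have "\<dots> \<le> d" unfolding d_def using \<open>finite A\<close> inv[OF y(1) i] by (intro Max_ge) auto
    finally have "\<bar>y - f\<bar> \<le> \<bar>y - f\<bar> * \<rho> i" using \<rho>i y(2) by (simp add: field_simps)
    moreover have "\<bar>y - f\<bar> * \<rho> i < \<bar>y - f\<bar> * 1" if "y \<noteq> f"
      using \<rho>i that by (intro mult_strict_left_mono) auto
    ultimately have "d = 0" using y(2) by fastforce
    moreover have "\<bar>x - f\<bar> \<le> d" unfolding d_def using \<open>finite A\<close> \<open>x \<in> A\<close> by (intro Max_ge) auto
    ultimately have "x = f" by simp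
    then show ?thesis using \<rho>i by (simp add: ifs_map_def f_def field_simps)
  qed
  with \<open>A \<noteq> {}\<close> no_fix show False by blast
qed

text \<open>The point of \<open>K\<close> farthest from a common fixed point is the image of a point
  of \<open>K\<close>, and contraction brings it strictly closer unless \<open>K\<close> is a single
  point.\<close>

lemma attractor_no_common_fixed_point:
  assumes \<rho>: "\<forall>i\<in>{1..m}. 0 < \<rho> i \<and> \<rho> i < 1" and K: "is_attractor m \<rho> t K"
    and "\<exists>x\<in>K. \<exists>y\<in>K. x \<noteq> y"
  shows "\<nexists>x. \<forall>i\<in>{1..m}. ifs_map \<rho> t i x = x"
proof
  assume "\<exists>x. \<forall>i\<in>{1..m}. ifs_map \<rho> t i x = x"
  then obtain x where x: "\<And>i. i \<in> {1..m} \<Longrightarrow> ifs_map \<rho> t i x = x" by blast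
  from K have "compact K" "K \<noteq> {}" and U: "K = (\<Union>i\<in>{1..m}. ifs_map \<rho> t i ` K)"
    unfolding is_attractor_def by auto
  then obtain y where y: "y \<in> K" "\<And>z. z \<in> K \<Longrightarrow> \<bar>z - x\<bar> \<le> \<bar>y - x\<bar>"
    using continuous_attains_sup[of K "\<lambda>z. \<bar>z - x\<bar>"] continuous_on_rabs[of K "\<lambda>z. z - x"]
    by (force intro: continuous_intros)
  from y(1) U obtain i z where i: "i \<in> {1..m}" and z: "z \<in> K" "y = ifs_map \<rho> t i z" by blast
  have \<rho>i: "0 < \<rho> i" "\<rho> i < 1" using \<rho>[rule_format, OF i] by auto
  have "y - x = ifs_map \<rho> t i z - ifs_map \<rho> t i x" using x[OF i] z(2) by simp
  also have "\<dots> = \<rho> i * (z - x)" by (simp add: ifs_map_def algebra_simps)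
  finally have "\<bar>y - x\<bar> = \<rho> i * \<bar>z - x\<bar>"
    using \<rho>i by (simp add: abs_mult)
  also have "\<dots> \<le> \<rho> i * \<bar>y - x\<bar>" using \<rho>i y(2)[OF z(1)] by (intro mult_left_mono) auto
  finally have "(1 - \<rho> i) * \<bar>y - x\<bar> \<le> 0" by (simp add: algebra_simps)
  then have "\<bar>y - x\<bar> \<le> 0" using \<rho>i by (auto simp: mult_le_0_iff)
  then have "z = x" if "z \<in> K" for z using y(2)[OF that] by simp
  with assms(3) show False by blast
qed

text \<open>\<open>nondegenerate\<close> excludes an attractor that is a single point: then all maps
  fix this point and \<open>\<mu>\<close> is the point mass there, for instance at 0, whose orbit is
  constant.\<close>

theorem corollary5p4:
  fixes m :: nat and \<rho> t :: "nat \<Rightarrow> real" and K :: "real set"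
    and c r s :: real and \<mu> :: "real measure"
  assumes "2 \<le> m"
    and "\<forall>i\<in>{1..m}. 0 < \<rho> i \<and> \<rho> i < 1"
    and "is_attractor m \<rho> t K"
    and nondegenerate: "\<exists>x\<in>K. \<exists>y\<in>K. x \<noteq> y"
    and "c \<in> K" and "K \<subseteq> interior (cball c r)"
    and "weak_separation m \<rho> t K (cball c r)"
    and "self_similar_measure m \<rho> t \<mu>"
    and "pisot s"
    and "\<exists>i\<in>{1..m}. ln s / ln (\<rho> i) \<notin> \<rat>"
  shows "pointwise_normal s \<mu>"
proof -
  have s: "1 < s" using \<open>pisot s\<close> by (simp add: pisot_def)
  have \<rho>: "0 < \<rho> i" "\<rho> i < 1" if "i \<in> {1..m}" for i using assms(2) that by auto
  from \<open>self_similar_measure m \<rho> t \<mu>\<close> obtain w where "prob_space \<mu>" and sets_\<mu>: "sets \<mu> = sets borel"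
    and w: "\<And>i. i \<in> {1..m} \<Longrightarrow> 0 < w i" "(\<Sum>i=1..m. w i) = 1"
    and \<mu>: "\<And>A. A \<in> sets borel \<Longrightarrow> measure \<mu> A = (\<Sum>i=1..m. w i * measure \<mu> (ifs_map \<rho> t i -` A))"
    unfolding self_similar_measure_def by blast
  interpret \<mu>: prob_space \<mu> by fact
  define p where "p = embed_pmf (\<lambda>i. if i \<in> {1..m} then w i else 0)"
  have pmf_p: "pmf p i = (if i \<in> {1..m} then w i else 0)" for i
    unfolding p_def
  proof (rule pmf_embed_pmf)
    have "(\<integral>\<^sup>+i. ennreal (if i \<in> {1..m} then w i else 0) \<partial>count_space UNIV) = (\<Sum>i=1..m. ennreal (w i))"
      by (subst nn_integral_count_space'[of "{1..m}"]) (auto simp: w(1) less_imp_le)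
    also have "\<dots> = 1" using w by (subst sum_ennreal) (auto intro: less_imp_le)
    finally show "(\<integral>\<^sup>+i. ennreal (if i \<in> {1..m} then w i else 0) \<partial>count_space UNIV) = 1" .
  qed (use w(1) in \<open>auto intro: less_imp_le\<close>)
  have integral_p: "(\<integral>i. h i \<partial>measure_pmf p) = (\<Sum>i=1..m. w i *\<^sub>R h i)"
    for h :: "nat \<Rightarrow> 'b::{banach, second_countable_topology}"
    by (subst integral_measure_pmf[of "{1..m}"]) (auto simp: set_pmf_eq pmf_p split: if_splits intro!: sum.cong)
  \<comment> \<open>The locale bounds range over all naturals, so letters outside the alphabet get
    harmless values; the \<open>insert\<close> of 1 and 0 below accounts for these.\<close>
  define \<alpha> where "\<alpha> i = (if i \<in> {1..m} then - log s (\<rho> i) else 1)" for i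
  define t' where "t' i = (if i \<in> {1..m} then t i else 0)" for i
  define a where "a = Min (insert 1 (\<alpha> ` {1..m}))"
  define J where "J = nat \<lceil>Max (insert 1 (\<alpha> ` {1..m}))\<rceil>"
  define \<tau> where "\<tau> = Max (insert 0 ((\<lambda>i. \<bar>t i\<bar>) ` {1..m}))"
  have \<alpha>_pos: "0 < \<alpha> i" for i using \<rho>[of i] s by (auto simp: \<alpha>_def)
  have \<rho>_eq: "s powr (- \<alpha> i) = \<rho> i" if "i \<in> {1..m}" for i
    using \<rho>[OF that] s that by (simp add: \<alpha>_def)
  interpret bernoulli_coding p \<alpha> t' s a \<tau> J
  proof
    show "1 < s" by fact
    show "0 < a" unfolding a_def using \<alpha>_pos by simp
    fix i
    have mem: "\<alpha> i \<in> insert 1 (\<alpha> ` {1..m})" by (auto simp: \<alpha>_def)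
    show "a \<le> \<alpha> i" unfolding a_def using mem by (intro Min_le) auto
    have "\<alpha> i \<le> Max (insert 1 (\<alpha> ` {1..m}))" using mem by (intro Max_ge) auto
    then show "\<alpha> i \<le> real J" unfolding J_def by linarith
    show "\<bar>t' i\<bar> \<le> \<tau>" unfolding \<tau>_def by (rule Max_ge) (auto simp: t'_def)
  qed
  have eq: "\<mu> = code_distr"
  proof (rule char_eqI_self_similar[where p = p and \<rho> = "\<lambda>i. s powr (- \<alpha> i)" and t = t'])
    show "real_distribution \<mu>"
      using sets_\<mu> sets_eq_imp_space_eq[OF sets_\<mu>] by unfold_locales auto
    show "real_distribution code_distr" by unfold_locales
    show "\<bar>s powr (- \<alpha> i)\<bar> \<le> s powr (- a)" for i using \<alpha>_lower[of i] s by (simp add: powr_mono)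
    show "char \<mu> \<xi> = (\<integral>i. iexp (\<xi> * t' i) * char \<mu> (s powr (- \<alpha> i) * \<xi>) \<partial>measure_pmf p)" for \<xi>
    proof (rule char_self_similar_measure[OF \<open>prob_space \<mu>\<close> sets_\<mu>])
      fix A :: "real set" assume "A \<in> sets borel"
      moreover have "(\<lambda>x. s powr (- \<alpha> i) * x + t' i) = ifs_map \<rho> t i" if "i \<in> {1..m}" for i
        using that by (auto simp: \<rho>_eq t'_def ifs_map_def)
      ultimately show "measure \<mu> A = (\<integral>i. measure \<mu> ((\<lambda>x. s powr (- \<alpha> i) * x + t' i) -` A) \<partial>measure_pmf p)"
        by (simp add: \<mu> integral_p)
    qed
    show "0 < s powr (- a)" "s powr (- a) < 1" by (rule r)+
    show "char code_distr \<xi> = (\<integral>i. iexp (\<xi> * t' i) * char code_distr (s powr (- \<alpha> i) * \<xi>) \<partial>measure_pmf p)" for \<xi>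
      by (rule char_code_self_similar)
  qed
  have "pointwise_normal s code_distr"
  proof (rule code_distr_pointwise_normal)
    show "measure code_distr {z} = 0" for z
      unfolding eq[symmetric]
    proof (rule self_similar_atomless[OF \<open>prob_space \<mu>\<close> sets_\<mu>])
      show "\<nexists>x. \<forall>i\<in>{1..m}. ifs_map \<rho> t i x = x"
        by (rule attractor_no_common_fixed_point[OF assms(2,3) nondegenerate])
      show "0 < \<rho> i \<and> \<rho> i < 1" if "i \<in> {1..m}" for i using \<rho>[OF that] by blast
    qed (fact w \<mu>)+
  next
    fix q :: int assume "q \<noteq> 0"
    show "(\<integral>i. iexp (2 * pi * of_int q * \<alpha> i) \<partial>measure_pmf p) \<noteq> 1"
    proof
      assume "(\<integral>i. iexp (2 * pi * of_int q * \<alpha> i) \<partial>measure_pmf p) = 1"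
      then have "(\<Sum>i=1..m. w i *\<^sub>R cis (2 * pi * of_int q * \<alpha> i)) = 1"
        unfolding integral_p cis_conv_exp .
      \<comment> \<open>A convex combination of cosines with positive weights equals 1 only if every
        cosine is 1. Hence \<open>q * \<alpha> i\<close> is an integer for every letter, including
        the irrational one.\<close>
      then have "Re (\<Sum>i=1..m. w i *\<^sub>R cis (2 * pi * of_int q * \<alpha> i)) = Re 1" by (rule arg_cong)
      then have "(\<Sum>i=1..m. w i * cos (2 * pi * of_int q * \<alpha> i)) = 1" by simp
      then have "(\<Sum>i=1..m. w i * (1 - cos (2 * pi * of_int q * \<alpha> i))) = 0"
        using w(2) by (simp add: right_diff_distrib sum_subtractf)
      then have all: "\<forall>i\<in>{1..m}. w i * (1 - cos (2 * pi * of_int q * \<alpha> i)) = 0"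
      proof (subst (asm) sum_nonneg_eq_0_iff)
        show "0 \<le> w i * (1 - cos (2 * pi * of_int q * \<alpha> i))" if "i \<in> {1..m}" for i
          using w(1)[OF that] by simp
      qed auto
      obtain i where i: "i \<in> {1..m}" "ln s / ln (\<rho> i) \<notin> \<rat>" using assms(10) by blast
      then have "cos (2 * pi * of_int q * \<alpha> i) = 1" using all w(1)[of i] by force
      then obtain n :: int where "2 * pi * of_int q * \<alpha> i = of_int n * 2 * pi"
        using cos_one_2pi_int by blast
      then have "of_int q * \<alpha> i = of_int n" by simp
      then have "\<alpha> i = of_int n / of_int q" using \<open>q \<noteq> 0\<close> by (simp add: field_simps)
      moreover have "ln s / ln (\<rho> i) = - (1 / \<alpha> i)"
        using i(1) s by (simp add: \<alpha>_def log_def)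
      ultimately have "ln s / ln (\<rho> i) \<in> \<rat>" by simp
      with i(2) show False by contradiction
    qed
  qed
  then show ?thesis by (simp add: eq)
qed

end
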